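(* Let $q \geq 8$ be a power of $2$, and let $G$ be a finite group with a minimal normal subgroup $N = \mathrm{PSL}_2(q)\times\cdots\times\mathrm{PSL}_2(q)$, a direct product of $k$ copies of $\mathrm{PSL}_2(q)$. Write $|G| = b(G)(b(G)+e)$. Then $e > \sqrt{b(G)}+1$, and in particular $|G| < e^4-e^3$.
   Context: $b(G)$ denotes the largest degree of a complex irreducible character of $G$. *)

theory Defs
  imports "HOL-Algebra.Algebra" "Jordan_Normal_Form.Matrix"
begin

text \<open>2x2 matrices (a b; c d) are encoded as quadruples (a,b,c,d).\<close>

definition mat2_mult :: "'f::field \<times> 'f \<times> 'f \<times> 'f \<Rightarrow> 'f \<times> 'f \<times> 'f \<times> 'f \<Rightarrow> 'f \<times> 'f \<times> 'f \<times> 'f" where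
  "mat2_mult x y = (case x of (a,b,c,d) \<Rightarrow> case y of (e,f,g,h) \<Rightarrow>
      (a*e + b*g, a*f + b*h, c*e + d*g, c*f + d*h))"

definition det2 :: "'f::field \<times> 'f \<times> 'f \<times> 'f \<Rightarrow> 'f" where
  "det2 x = (case x of (p,r,s,t) \<Rightarrow> p*t - r*s)"

definition SL2 :: "('f::field \<times> 'f \<times> 'f \<times> 'f) monoid" where
  "SL2 = \<lparr> carrier = {x. det2 x = 1},
           monoid.mult = mat2_mult,
           one = (1,0,0,1) \<rparr>"

definition SL2_centre :: "('f::field \<times> 'f \<times> 'f \<times> 'f) set" where
  "SL2_centre = {(l,0,0,l) | l. l*l = 1}"

definition PSL2 :: "(('f::field \<times> 'f \<times> 'f \<times> 'f) set) monoid" where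
  "PSL2 = SL2 Mod SL2_centre"

definition minimal_normal :: "('g, 'b) monoid_scheme \<Rightarrow> 'g set \<Rightarrow> bool" where
  "minimal_normal G N \<longleftrightarrow> N \<lhd> G \<and> N \<noteq> {\<one>\<^bsub>G\<^esub>} \<and>
     (\<forall>M. M \<lhd> G \<and> M \<subseteq> N \<longrightarrow> M = {\<one>\<^bsub>G\<^esub>} \<or> M = N)"

definition complex_rep :: "('g, 'b) monoid_scheme \<Rightarrow> nat \<Rightarrow> ('g \<Rightarrow> complex mat) \<Rightarrow> bool" where
  "complex_rep G n \<rho> \<longleftrightarrow>
     (\<forall>g\<in>carrier G. \<rho> g \<in> carrier_mat n n) \<and>
     (\<forall>g\<in>carrier G. \<forall>h\<in>carrier G. \<rho> (g \<otimes>\<^bsub>G\<^esub> h) = \<rho> g * \<rho> h) \<and>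
     \<rho> \<one>\<^bsub>G\<^esub> = 1\<^sub>m n"

definition is_subspace :: "nat \<Rightarrow> complex vec set \<Rightarrow> bool" where
  "is_subspace n W \<longleftrightarrow> W \<subseteq> carrier_vec n \<and> 0\<^sub>v n \<in> W \<and>
     (\<forall>v\<in>W. \<forall>w\<in>W. v + w \<in> W) \<and> (\<forall>c. \<forall>v\<in>W. c \<cdot>\<^sub>v v \<in> W)"

definition irreducible_rep :: "('g, 'b) monoid_scheme \<Rightarrow> nat \<Rightarrow> ('g \<Rightarrow> complex mat) \<Rightarrow> bool" where
  "irreducible_rep G n \<rho> \<longleftrightarrow> complex_rep G n \<rho> \<and> n > 0 \<and>
     (\<forall>W. is_subspace n W \<and> (\<forall>g\<in>carrier G. \<forall>w\<in>W. \<rho> g *\<^sub>v w \<in> W)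
          \<longrightarrow> W = {0\<^sub>v n} \<or> W = carrier_vec n)"

text \<open>b(G): the largest degree of a complex irreducible character of G
  (= largest dimension of an irreducible complex representation).\<close>
definition b_max :: "('g, 'b) monoid_scheme \<Rightarrow> nat" where
  "b_max G = Max {n. \<exists>\<rho>. irreducible_rep G n \<rho>}"

end

theory Submission
  imports "Jordan_Normal_Form.Spectral_Radius" Defs
begin

text \<open>
  Write \<open>d = b(G)\<close>. The inequality \<open>18 d\<^sup>2 \<le> 11 |G|\<close> suffices: it gives \<open>e \<ge> 7 d / 11\<close>, and for small \<open>d\<close> one uses
  \<open>|G| \<ge> |N| \<ge> 504\<close>.

  Let \<open>S = SL\<^sub>2(q)\<close>, and let \<open>a = q\<^sup>-\<^sup>1 \<Sum> {x. x\<^sup>2 = 1}\<close> in the group algebra of \<open>S\<close>. It acts on the irreducible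
  representations of degree \<open>q + 1\<close>, \<open>q - 1\<close>, \<open>q\<close> (Steinberg) and \<open>1\<close> by the scalars \<open>1\<close>, \<open>-1\<close>, \<open>1/q\<close> and \<open>q\<close>. Hence
  there is a positive element \<open>p = c * c\<close> such that \<open>s = a * p\<close> is the sign of \<open>a\<close>: \<open>s * s = 1\<close>. The
  coefficient of \<open>s\<close> at the identity is \<open>2/(q + 1) \<le> 2/9\<close>. All of this passes to tensor powers, that is, to \<open>N\<close>.

  On an irreducible representation of \<open>G\<close> the element \<open>a\<close> of the group algebra of \<open>N\<close> acts as a scalar, because
  \<open>{x \<in> N. x\<^sup>2 = 1}\<close> is invariant under conjugation. Since \<open>p\<close> has only nonnegative eigenvalues and \<open>s\<close> is an
  involution, \<open>s\<close> acts as a scalar \<open>\<sigma> = \<plusminus>1\<close>. So \<open>1 + \<sigma> s\<close> has trace \<open>2 n\<close> in degree \<open>n\<close>, and the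
  Cauchy-Schwarz inequality together with \<open>\<Sum> |\<chi>(g)|\<^sup>2 = |G|\<close> gives \<open>4 n\<^sup>2 \<le> |G| (2 + 2 \<sigma> s(1))\<close>.
\<close>

section \<open>Convolution and sign elements\<close>

definition conv :: "('a, 'b) monoid_scheme \<Rightarrow> ('a \<Rightarrow> real) \<Rightarrow> ('a \<Rightarrow> real) \<Rightarrow> 'a \<Rightarrow> real" where
  "conv G f g x = (\<Sum>y\<in>carrier G. f y * g (inv\<^bsub>G\<^esub> y \<otimes>\<^bsub>G\<^esub> x))"

definition dirac :: "('a, 'b) monoid_scheme \<Rightarrow> 'a \<Rightarrow> real" where
  "dirac G x = (if x = \<one>\<^bsub>G\<^esub> then 1 else 0)"

definition sqrt_one :: "('a, 'b) monoid_scheme \<Rightarrow> real \<Rightarrow> 'a \<Rightarrow> real" where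
  "sqrt_one G r x = (if x \<otimes>\<^bsub>G\<^esub> x = \<one>\<^bsub>G\<^esub> then r else 0)"

text \<open>\<open>v\<close> is the coefficient of the sign element \<open>s\<close> at the identity. Positivity of the second factor is
  recorded by writing it as the square of a self-adjoint element \<open>c\<close>.\<close>

definition sign_element :: "('a, 'b) monoid_scheme \<Rightarrow> real \<Rightarrow> bool" where
  "sign_element G v \<longleftrightarrow> (\<exists>r c s.
     (\<forall>x\<in>carrier G. c (inv\<^bsub>G\<^esub> x) = c x \<and> s (inv\<^bsub>G\<^esub> x) = s x
        \<and> conv G s s x = dirac G x \<and> conv G (sqrt_one G r) (conv G c c) x = s x) \<and>
     s \<one>\<^bsub>G\<^esub> = v)"

section \<open>The real group algebra: associativity, unit, inversion and coefficient sums\<close>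

context group
begin

lemma conv_cong:
  assumes "\<And>x. x \<in> carrier G \<Longrightarrow> f x = f' x" "\<And>x. x \<in> carrier G \<Longrightarrow> g x = g' x" "x \<in> carrier G"
  shows "conv G f g x = conv G f' g' x"
  unfolding conv_def using assms by (intro sum.cong) auto

lemma mult_inv_cancel:
  assumes "x \<in> carrier G" "y \<in> carrier G"
  shows "x \<otimes> (inv x \<otimes> y) = y" "inv x \<otimes> (x \<otimes> y) = y"
  using assms by (simp_all add: m_assoc[symmetric])

lemma sum_translate:
  fixes f :: "'a \<Rightarrow> 'c::comm_monoid_add"
  assumes "y \<in> carrier G"
  shows "(\<Sum>x\<in>carrier G. f (inv y \<otimes> x)) = sum f (carrier G)"
  by (rule sum.reindex_bij_witness[where i="\<lambda>x. y \<otimes> x" and j="\<lambda>x. inv y \<otimes> x"])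
     (use assms in \<open>auto simp: m_assoc[symmetric]\<close>)

lemma sum_inverse:
  fixes f :: "'a \<Rightarrow> 'c::comm_monoid_add"
  shows "(\<Sum>x\<in>carrier G. f (inv x)) = sum f (carrier G)"
  by (rule sum.reindex_bij_witness[where i="\<lambda>x. inv x" and j="\<lambda>x. inv x"]) auto

lemma conv_assoc:
  assumes "x \<in> carrier G"
  shows "conv G (conv G f g) h x = conv G f (conv G g h) x"
proof -
  have "conv G (conv G f g) h x = (\<Sum>y\<in>carrier G. \<Sum>z\<in>carrier G. f z * g (inv z \<otimes> y) * h (inv y \<otimes> x))"
    by (simp add: conv_def sum_distrib_right)
  also have "\<dots> = (\<Sum>z\<in>carrier G. \<Sum>y\<in>carrier G. f z * g (inv z \<otimes> y) * h (inv y \<otimes> x))"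
    by (rule sum.swap)
  also have "\<dots> = (\<Sum>z\<in>carrier G. f z * conv G g h (inv z \<otimes> x))"
  proof (rule sum.cong[OF refl])
    fix z assume z: "z \<in> carrier G"
    have "(\<Sum>y\<in>carrier G. f z * g (inv z \<otimes> y) * h (inv y \<otimes> x))
        = (\<Sum>y\<in>carrier G. (\<lambda>w. f z * (g w * h (inv w \<otimes> (inv z \<otimes> x)))) (inv z \<otimes> y))"
      using z assms by (intro sum.cong) (auto simp: inv_mult_group m_assoc mult_inv_cancel)
    also have "\<dots> = f z * conv G g h (inv z \<otimes> x)"
      by (subst sum_translate[OF z]) (simp add: conv_def sum_distrib_left)
    finally show "(\<Sum>y\<in>carrier G. f z * g (inv z \<otimes> y) * h (inv y \<otimes> x)) = f z * conv G g h (inv z \<otimes> x)" .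
  qed
  finally show ?thesis by (simp add: conv_def)
qed

lemma conv_dirac_left:
  assumes "finite (carrier G)" "x \<in> carrier G"
  shows "conv G (dirac G) f x = f x"
proof -
  have "conv G (dirac G) f x = (\<Sum>y\<in>carrier G. if y = \<one> then f x else 0)"
    unfolding conv_def dirac_def using assms by (intro sum.cong) auto
  then show ?thesis using assms by simp
qed

lemma conv_dirac_right:
  assumes "finite (carrier G)" "x \<in> carrier G"
  shows "conv G f (dirac G) x = f x"
proof -
  have "inv y \<otimes> x = \<one> \<longleftrightarrow> y = x" if "y \<in> carrier G" for y
    using that assms by (metis inv_closed inv_equality inv_inv l_inv)
  then have "conv G f (dirac G) x = (\<Sum>y\<in>carrier G. if y = x then f x else 0)"
    unfolding conv_def dirac_def by (intro sum.cong) auto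
  then show ?thesis using assms by simp
qed

text \<open>Inversion of group elements reverses products in the group algebra. For
  inversion-symmetric factors this turns a relation for a product on one side into the relation on
  the other side.\<close>

lemma conv_inv:
  assumes "\<And>x. x \<in> carrier G \<Longrightarrow> f (inv x) = f x" "\<And>x. x \<in> carrier G \<Longrightarrow> g (inv x) = g x" "x \<in> carrier G"
  shows "conv G f g (inv x) = conv G g f x"
  unfolding conv_def
proof (rule sum.reindex_bij_witness[where i="\<lambda>y. inv x \<otimes> y" and j="\<lambda>y. x \<otimes> y"])
  fix y assume y: "y \<in> carrier G"
  have "g (inv y \<otimes> inv x) = g (x \<otimes> y)"
    using assms(2)[of "x \<otimes> y"] assms(3) y by (simp add: inv_mult_group)
  moreover have "inv (x \<otimes> y) \<otimes> x = inv y"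
    using assms(3) y by (simp add: inv_mult_group m_assoc)
  ultimately show "g (x \<otimes> y) * f (inv (x \<otimes> y) \<otimes> x) = f y * g (inv y \<otimes> inv x)"
    using assms(1) y by simp
qed (use assms(3) in \<open>auto simp: mult_inv_cancel\<close>)

lemma conv_const_left:
  assumes "x \<in> carrier G"
  shows "conv G (\<lambda>_. k) f x = k * sum f (carrier G)"
proof -
  have "conv G (\<lambda>_. k) f x = k * (\<Sum>y\<in>carrier G. f (inv (inv x \<otimes> y)))"
    unfolding conv_def sum_distrib_left using assms by (intro sum.cong) (auto simp: inv_mult_group)
  also have "(\<Sum>y\<in>carrier G. f (inv (inv x \<otimes> y))) = (\<Sum>y\<in>carrier G. f (inv y))"
    by (rule sum_translate[OF assms, where f="\<lambda>y. f (inv y)"])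
  finally show ?thesis by (simp add: sum_inverse)
qed

text \<open>The coefficient sum is the trivial representation of the group algebra, hence
  multiplicative.\<close>

lemma sum_conv:
  "sum (conv G f g) (carrier G) = sum f (carrier G) * sum g (carrier G)"
proof -
  have "sum (conv G f g) (carrier G) = (\<Sum>y\<in>carrier G. \<Sum>x\<in>carrier G. f y * g (inv y \<otimes> x))"
    unfolding conv_def by (rule sum.swap)
  also have "\<dots> = (\<Sum>y\<in>carrier G. f y * sum g (carrier G))"
    by (intro sum.cong refl) (simp add: sum_distrib_left[symmetric] sum_translate)
  finally show ?thesis by (simp add: sum_distrib_right)
qed

end

lemma conv_add_left: "conv G (\<lambda>x. f x + g x) h x = conv G f h x + conv G g h x"
  by (simp add: conv_def distrib_right sum.distrib)
lemma conv_scale_left: "conv G (\<lambda>x. k * f x) h x = k * conv G f h x"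
  by (simp add: conv_def sum_distrib_left mult.assoc)
lemma conv_add_right: "conv G h (\<lambda>x. f x + g x) x = conv G h f x + conv G h g x"
  by (simp add: conv_def distrib_left sum.distrib)
lemma conv_scale_right: "conv G h (\<lambda>x. k * f x) x = k * conv G h f x"
  by (simp add: conv_def sum_distrib_left mult.left_commute)

text \<open>\<open>E\<close> is the central idempotent of the Steinberg representation and \<open>1 / card (carrier G)\<close> that of the
  trivial one; \<open>sqrt Q\<close> enters because \<open>c * c\<close> must invert \<open>|a|\<close>.\<close>

lemma (in group) sign_elementI:
  fixes Q :: real
  defines "a \<equiv> sqrt_one G (1 / Q)"
  assumes fin: "finite (carrier G)" and Q: "Q > 1"
    and sum_a: "sum a (carrier G) = Q"
    and E_inv: "\<And>x. x \<in> carrier G \<Longrightarrow> E (inv x) = E x"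
    and aE: "\<And>x. x \<in> carrier G \<Longrightarrow> conv G a E x = E x / Q"
    and aa: "\<And>x. x \<in> carrier G \<Longrightarrow>
      conv G a a x = dirac G x + (1 / Q\<^sup>2 - 1) * E x + (Q\<^sup>2 - 1) / card (carrier G)"
  shows "sign_element G (1 / Q + (1 - 1 / Q) * E \<one> + (1 - Q) / card (carrier G))"
proof -
  define F :: "'a \<Rightarrow> real" where "F = (\<lambda>_. 1 / card (carrier G))"
  have ord: "real (card (carrier G)) > 0" using fin by (simp add: card_gt_0_iff) blast
  have Q2: "Q\<^sup>2 > 1" using Q by (simp add: one_less_power)
  have sumF: "sum F (carrier G) = 1" using ord by (simp add: F_def)
  have conv_F: "conv G F f x = sum f (carrier G) * F x" if "x \<in> carrier G" for f x
    using conv_const_left[OF that, of "F \<one>" f] by (simp add: F_def)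
  have conv_F_right: "conv G f F x = sum f (carrier G) * F x" for f x
    by (simp add: conv_def F_def sum_distrib_right sum_divide_distrib)
  have aa': "conv G a a x = dirac G x + (1 / Q\<^sup>2 - 1) * E x + (Q\<^sup>2 - 1) * F x" if "x \<in> carrier G" for x
    using aa[OF that] by (simp add: F_def)
  \<comment> \<open>Take coefficient sums in the relation for \<open>conv G a a\<close>: the terms
    without \<open>E\<close> already balance, and \<open>E\<close> enters with a nonzero factor
    because \<open>Q > 1\<close>.\<close>
  have sumE: "sum E (carrier G) = 0"
  proof -
    have "sum (dirac G) (carrier G) = 1" using fin by (simp add: dirac_def)
    then have "Q * Q = 1 + (1 / Q\<^sup>2 - 1) * sum E (carrier G) + (Q\<^sup>2 - 1)"
      using sum_conv[of a a] sumF by (simp add: aa' sum_a sum.distrib sum_distrib_left[symmetric])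
    then have "(1 / Q\<^sup>2 - 1) * sum E (carrier G) = 0" by (simp add: power2_eq_square)
    moreover have "1 / Q\<^sup>2 - 1 \<noteq> 0" using Q by (simp add: power2_eq_1_iff)
    ultimately show ?thesis by (metis mult_eq_0_iff right_minus_eq)
  qed
  \<comment> \<open>Evaluate the product of \<open>a\<close>, \<open>a\<close> and \<open>E\<close>
    in two ways. The \<open>F\<close> term dies by \<open>sumE\<close>, which leaves a linear
    equation for \<open>conv G E E\<close>.\<close>
  have EE: "conv G E E x = E x" if x: "x \<in> carrier G" for x
  proof -
    have "E x / Q\<^sup>2 = conv G a (\<lambda>x. (1 / Q) * E x) x"
      unfolding conv_scale_right using aE[OF x] by (simp add: power2_eq_square)
    also have "\<dots> = conv G a (conv G a E) x" using x by (intro conv_cong) (auto simp: aE)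
    also have "\<dots> = conv G (conv G a a) E x" using x by (simp add: conv_assoc)
    also have "\<dots> = conv G (\<lambda>x. dirac G x + (1 / Q\<^sup>2 - 1) * E x + (Q\<^sup>2 - 1) * F x) E x"
      using x by (intro conv_cong) (auto simp: aa')
    also have "\<dots> = E x + (1 / Q\<^sup>2 - 1) * conv G E E x"
      unfolding conv_add_left conv_scale_left using x fin by (simp add: conv_F sumE conv_dirac_left)
    finally have "(1 / Q\<^sup>2 - 1) * (conv G E E x - E x) = 0" by (simp add: algebra_simps)
    moreover have "1 / Q\<^sup>2 - 1 \<noteq> 0" using Q by (simp add: power2_eq_1_iff)
    ultimately show ?thesis by (metis mult_eq_0_iff right_minus_eq)
  qed
  have a_inv: "a (inv x) = a x" if "x \<in> carrier G" for x
  proof -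
    have "inv x \<otimes> inv x = inv (x \<otimes> x)" using that by (simp add: inv_mult_group)
    then have "inv x \<otimes> inv x = \<one> \<longleftrightarrow> x \<otimes> x = \<one>"
      using that by (simp add: inv_eq_1_iff)
    then show ?thesis by (simp add: a_def sqrt_one_def)
  qed
  have Ea: "conv G E a x = E x / Q" if "x \<in> carrier G" for x
    using conv_inv[of a E x] aE[of "inv x"] that a_inv E_inv by simp
  have dirac_inv: "dirac G (inv x) = dirac G x" if "x \<in> carrier G" for x
    using that by (simp add: dirac_def inv_eq_1_iff)
  \<comment> \<open>\<open>E\<close>, \<open>F\<close> and their complement are orthogonal
    idempotents. On them \<open>c\<close> takes the values \<open>sqrt Q\<close>,
    \<open>1 / sqrt Q\<close> and \<open>1\<close>, so its square takes the values \<open>Q\<close>,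
    \<open>1 / Q\<close> and \<open>1\<close>.\<close>
  define c where "c = (\<lambda>x. dirac G x + (sqrt Q - 1) * E x + (1 / sqrt Q - 1) * F x)"
  \<comment> \<open>The corrections replace the values \<open>1 / Q\<close> and \<open>Q\<close> of
    \<open>a\<close> on \<open>E\<close> and \<open>F\<close> by \<open>1\<close>; on the complement
    \<open>a\<close> already squares to one.\<close>
  define s where "s = (\<lambda>x. a x + (1 - 1 / Q) * E x + (1 - Q) * F x)"
  note rules = conv_add_left conv_scale_left conv_add_right conv_scale_right
  note vals = conv_F conv_F_right sumE sumF sum_a EE aE Ea aa' conv_dirac_left conv_dirac_right fin
  have sumd: "sum (dirac G) (carrier G) = 1" using fin by (simp add: dirac_def)
  have cc: "conv G c c x = dirac G x + (Q - 1) * E x + (1 / Q - 1) * F x" if x: "x \<in> carrier G" for x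
  proof -
    have "conv G c c x = dirac G x + (2 * (sqrt Q - 1) + (sqrt Q - 1)\<^sup>2) * E x
        + (2 * (1 / sqrt Q - 1) + (1 / sqrt Q - 1)\<^sup>2) * F x"
      unfolding c_def rules using x by (simp add: vals sumd algebra_simps power2_eq_square)
    also have "2 * (sqrt Q - 1) + (sqrt Q - 1)\<^sup>2 = Q - 1" using Q by (simp add: power2_eq_square algebra_simps)
    also have "2 * (1 / sqrt Q - 1) + (1 / sqrt Q - 1)\<^sup>2 = 1 / Q - 1" using Q by (simp add: power2_eq_square algebra_simps)
    finally show ?thesis .
  qed
  have acc: "conv G a (conv G c c) x = s x" if x: "x \<in> carrier G" for x
  proof -
    have "conv G a (conv G c c) x = conv G a (\<lambda>x. dirac G x + (Q - 1) * E x + (1 / Q - 1) * F x) x"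
      using x by (intro conv_cong) (auto simp: cc)
    also have "\<dots> = s x" unfolding rules s_def using x Q by (simp add: vals field_simps)
    finally show ?thesis .
  qed
  have ss: "conv G s s x = dirac G x" if x: "x \<in> carrier G" for x
  proof -
    have "conv G s s x = dirac G x + ((1 / Q\<^sup>2 - 1) + 2 * (1 - 1 / Q) / Q + (1 - 1 / Q)\<^sup>2) * E x
      + ((Q\<^sup>2 - 1) + 2 * (1 - Q) * Q + (1 - Q)\<^sup>2) * F x"
      unfolding rules s_def using x Q by (simp add: vals) (simp add: field_simps power2_eq_square)
    also have "(1 / Q\<^sup>2 - 1) + 2 * (1 - 1 / Q) / Q + (1 - 1 / Q)\<^sup>2 = 0"
      using Q by (simp add: field_simps power2_eq_square)
    also have "(Q\<^sup>2 - 1) + 2 * (1 - Q) * Q + (1 - Q)\<^sup>2 = 0"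
      by (simp add: algebra_simps power2_eq_square)
    finally show ?thesis by simp
  qed
  show ?thesis unfolding sign_element_def
  proof (intro exI conjI ballI)
    fix x assume x: "x \<in> carrier G"
    show "c (inv x) = c x" using x by (simp add: c_def dirac_inv E_inv F_def)
    show "s (inv x) = s x" using x by (simp add: s_def a_inv E_inv F_def)
    show "conv G s s x = dirac G x" using ss[OF x] .
    show "conv G (sqrt_one G (1 / Q)) (conv G c c) x = s x" using acc[OF x] by (simp add: a_def)
  qed (simp add: s_def a_def sqrt_one_def F_def)
qed

section \<open>Sign elements under isomorphisms and in direct powers\<close>

lemma conv_iso:
  assumes "group G" "group H" "h \<in> iso G H" "x \<in> carrier G"
  shows "conv G (\<lambda>x. f (h x)) (\<lambda>x. g (h x)) x = conv H f g (h x)"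
proof -
  interpret group_hom G H h using assms by (simp add: group_hom_def group_hom_axioms_def iso_def)
  have b: "bij_betw h (carrier G) (carrier H)" using assms by (auto simp: iso_def)
  have "conv H f g (h x) = (\<Sum>y\<in>carrier G. f (h y) * g (inv\<^bsub>H\<^esub> (h y) \<otimes>\<^bsub>H\<^esub> h x))"
    unfolding conv_def by (rule sum.reindex_bij_betw[OF b, symmetric])
  also have "\<dots> = conv G (\<lambda>x. f (h x)) (\<lambda>x. g (h x)) x"
    unfolding conv_def using assms(4) by (intro sum.cong) auto
  finally show ?thesis by simp
qed

lemma sign_element_iso:
  assumes G: "group G" and H: "group H" and h: "h \<in> iso G H" and s: "sign_element H v"
  shows "sign_element G v"
proof -
  interpret group_hom G H h using assms by (simp add: group_hom_def group_hom_axioms_def iso_def)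
  have b: "inj_on h (carrier G)" using assms by (auto simp: iso_def bij_betw_def)
  obtain r c s where s: "\<And>x. x \<in> carrier H \<Longrightarrow> c (inv\<^bsub>H\<^esub> x) = c x \<and> s (inv\<^bsub>H\<^esub> x) = s x
        \<and> conv H s s x = dirac H x \<and> conv H (sqrt_one H r) (conv H c c) x = s x" and v: "s \<one>\<^bsub>H\<^esub> = v"
    using s by (auto simp: sign_element_def)
  have inj1: "h x = \<one>\<^bsub>H\<^esub> \<longleftrightarrow> x = \<one>\<^bsub>G\<^esub>" if "x \<in> carrier G" for x
    using b that by (metis G.one_closed hom_one inj_onD)
  show ?thesis unfolding sign_element_def
  proof (intro exI conjI ballI)
    fix x assume x: "x \<in> carrier G"
    note sx = s[OF hom_closed[OF x]]
    show "c (h (inv\<^bsub>G\<^esub> x)) = c (h x)" "s (h (inv\<^bsub>G\<^esub> x)) = s (h x)" using sx x by auto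
    show "conv G (\<lambda>x. s (h x)) (\<lambda>x. s (h x)) x = dirac G x"
      using sx x by (simp add: conv_iso[OF G H h] dirac_def inj1)
    have "conv G (sqrt_one G r) (conv G (\<lambda>x. c (h x)) (\<lambda>x. c (h x))) x
        = conv G (\<lambda>x. sqrt_one H r (h x)) (\<lambda>x. conv H c c (h x)) x"
      by (rule G.conv_cong) (use x inj1 in \<open>auto simp: conv_iso[OF G H h] sqrt_one_def simp flip: hom_mult\<close>)
    also have "\<dots> = s (h x)" using sx x by (simp add: conv_iso[OF G H h])
    finally show "conv G (sqrt_one G r) (conv G (\<lambda>x. c (h x)) (\<lambda>x. c (h x))) x = s (h x)" .
  qed (use v in auto)
qed

text \<open>Distributivity: a product over \<open>I\<close> of sums is a single sum over choice
  functions, and these are the elements of the direct power.\<close>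

lemma conv_product_group:
  assumes "group G" "finite I" "finite (carrier G)" "x \<in> carrier (product_group I (\<lambda>_. G))"
  shows "conv (product_group I (\<lambda>_. G)) (\<lambda>x. \<Prod>i\<in>I. f (x i)) (\<lambda>x. \<Prod>i\<in>I. g (x i)) x
       = (\<Prod>i\<in>I. conv G f g (x i))"
proof -
  have "(\<Prod>i\<in>I. conv G f g (x i)) = (\<Sum>y\<in>PiE I (\<lambda>_. carrier G). \<Prod>i\<in>I. f (y i) * g (inv\<^bsub>G\<^esub> (y i) \<otimes>\<^bsub>G\<^esub> x i))"
    unfolding conv_def using assms by (intro prod_sum_PiE) auto
  also have "\<dots> = conv (product_group I (\<lambda>_. G)) (\<lambda>x. \<Prod>i\<in>I. f (x i)) (\<lambda>x. \<Prod>i\<in>I. g (x i)) x"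
    unfolding conv_def carrier_product_group
  proof (rule sum.cong[OF refl])
    fix y assume y: "y \<in> PiE I (\<lambda>_. carrier G)"
    show "(\<Prod>i\<in>I. f (y i) * g (inv\<^bsub>G\<^esub> y i \<otimes>\<^bsub>G\<^esub> x i)) = (\<Prod>i\<in>I. f (y i)) *
         (\<Prod>i\<in>I. g ((inv\<^bsub>product_group I (\<lambda>_. G)\<^esub> y \<otimes>\<^bsub>product_group I (\<lambda>_. G)\<^esub> x) i))"
      unfolding prod.distrib by (subst inv_product_group[OF y]) (use assms in \<open>auto intro!: prod.cong\<close>)
  qed
  finally show ?thesis by simp
qed

text \<open>Tensor powers of \<open>c\<close> and \<open>s\<close> work coordinate by coordinate. An
  element of the direct power squares to one exactly when all its coordinates do, so the tensor
  power of \<open>sqrt_one\<close> is again a \<open>sqrt_one\<close>, with factor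
  \<open>r ^ card I\<close>.\<close>

lemma sign_element_product_group:
  assumes G: "group G" and I: "finite I" and fin: "finite (carrier G)" and s: "sign_element G v"
  shows "sign_element (product_group I (\<lambda>_. G)) (v ^ card I)"
proof -
  let ?P = "product_group I (\<lambda>_. G)"
  interpret P: group ?P using G by simp
  obtain r c s where s: "\<And>x. x \<in> carrier G \<Longrightarrow> c (inv\<^bsub>G\<^esub> x) = c x \<and> s (inv\<^bsub>G\<^esub> x) = s x
        \<and> conv G s s x = dirac G x \<and> conv G (sqrt_one G r) (conv G c c) x = s x" and v: "s \<one>\<^bsub>G\<^esub> = v"
    using s by (auto simp: sign_element_def)
  note conv = conv_product_group[OF G I fin]
  \<comment> \<open>Elements of the direct power are extensional functions, so agreement on
    \<open>I\<close> is equality. This serves both for \<open>dirac\<close> and for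
    \<open>sqrt_one\<close>.\<close>
  have delta: "(\<Prod>i\<in>I. if x i = y i then k else 0) = (if x = y then k ^ card I else 0)"
    if "x \<in> extensional I" "y \<in> extensional I" for x y :: "'c \<Rightarrow> 'a" and k :: real
    using that I extensionalityI[OF that] by (auto simp: prod_zero_iff)
  show ?thesis unfolding sign_element_def
  proof (intro exI conjI ballI)
    fix x assume x: "x \<in> carrier ?P"
    have xi: "x i \<in> carrier G" if "i \<in> I" for i using x that by auto
    have xe: "x \<in> extensional I" using x by (auto simp: PiE_def)
    have inv: "inv\<^bsub>?P\<^esub> x = (\<lambda>i\<in>I. inv\<^bsub>G\<^esub> x i)" using x G by auto
    show "(\<Prod>i\<in>I. c ((inv\<^bsub>?P\<^esub> x) i)) = (\<Prod>i\<in>I. c (x i))"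
      "(\<Prod>i\<in>I. s ((inv\<^bsub>?P\<^esub> x) i)) = (\<Prod>i\<in>I. s (x i))"
      unfolding inv using s xi by (auto intro!: prod.cong)
    have "(\<Prod>i\<in>I. conv G s s (x i)) = (\<Prod>i\<in>I. if x i = (\<lambda>i\<in>I. \<one>\<^bsub>G\<^esub>) i then 1 else 0)"
      using s xi by (intro prod.cong) (auto simp: dirac_def)
    also have "\<dots> = dirac ?P x" using xe by (subst delta) (auto simp: dirac_def)
    finally show "conv ?P (\<lambda>x. \<Prod>i\<in>I. s (x i)) (\<lambda>x. \<Prod>i\<in>I. s (x i)) x = dirac ?P x"
      using conv[OF x] by simp
    have "conv ?P (sqrt_one ?P (r ^ card I)) (conv ?P (\<lambda>x. \<Prod>i\<in>I. c (x i)) (\<lambda>x. \<Prod>i\<in>I. c (x i))) x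
        = conv ?P (\<lambda>x. \<Prod>i\<in>I. sqrt_one G r (x i)) (\<lambda>x. \<Prod>i\<in>I. conv G c c (x i)) x"
    proof (rule P.conv_cong[OF _ _ x])
      fix y assume y: "y \<in> carrier ?P"
      have "(\<Prod>i\<in>I. sqrt_one G r (y i)) = (\<Prod>i\<in>I. if (\<lambda>i\<in>I. y i \<otimes>\<^bsub>G\<^esub> y i) i = (\<lambda>i\<in>I. \<one>\<^bsub>G\<^esub>) i then r else 0)"
        by (intro prod.cong) (auto simp: sqrt_one_def)
      also have "\<dots> = sqrt_one ?P (r ^ card I) y"
        by (subst delta) (auto simp: sqrt_one_def)
      finally show "sqrt_one ?P (r ^ card I) y = (\<Prod>i\<in>I. sqrt_one G r (y i))" by simp
    qed (rule conv)
    also have "\<dots> = (\<Prod>i\<in>I. s (x i))" using conv[OF x] s xi by (auto intro!: prod.cong)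
    finally show "conv ?P (sqrt_one ?P (r ^ card I)) (conv ?P (\<lambda>x. \<Prod>i\<in>I. c (x i)) (\<lambda>x. \<Prod>i\<in>I. c (x i))) x
        = (\<Prod>i\<in>I. s (x i))" .
  qed (use v in auto)
qed

section \<open>The sign element of SL2 in characteristic 2\<close>

lemma group_SL2: "group (SL2 :: ('f::field \<times> 'f \<times> 'f \<times> 'f) monoid)"
proof (rule groupI)
  fix x y z :: "'f \<times> 'f \<times> 'f \<times> 'f"
  show "\<one>\<^bsub>SL2\<^esub> \<in> carrier (SL2 :: ('f \<times> 'f \<times> 'f \<times> 'f) monoid)"
    by (simp add: SL2_def det2_def)
  assume x: "x \<in> carrier SL2"
  obtain a b c d where [simp]: "x = (a,b,c,d)" by (cases x)
  have ad: "a*d - b * c = 1" using x by (simp add: SL2_def det2_def)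
  show "\<one>\<^bsub>SL2\<^esub> \<otimes>\<^bsub>SL2\<^esub> x = x" by (simp add: SL2_def mat2_mult_def)
  show "\<exists>y\<in>carrier SL2. y \<otimes>\<^bsub>SL2\<^esub> x = \<one>\<^bsub>SL2\<^esub>"
    by (rule bexI[of _ "(d,-b,-c,a)"]) (use ad in \<open>auto simp: SL2_def det2_def mat2_mult_def algebra_simps\<close>)
  obtain e f g h where [simp]: "y = (e,f,g,h)" by (cases y)
  obtain k l m n where [simp]: "z = (k,l,m,n)" by (cases z)
  show "x \<otimes>\<^bsub>SL2\<^esub> y \<otimes>\<^bsub>SL2\<^esub> z = x \<otimes>\<^bsub>SL2\<^esub> (y \<otimes>\<^bsub>SL2\<^esub> z)"
    by (simp add: SL2_def mat2_mult_def algebra_simps)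
  assume y: "y \<in> carrier SL2"
  have eh: "e*h - f*g = 1" using y by (simp add: SL2_def det2_def)
  have "(a*e+b*g)*(c*f+d*h) - (a*f+b*h)*(c*e+d*g) = (a*d - b * c) * (e*h - f*g)"
    by (simp add: algebra_simps)
  then show "x \<otimes>\<^bsub>SL2\<^esub> y \<in> carrier SL2" using ad eh by (simp add: SL2_def det2_def mat2_mult_def)
qed

section \<open>Finite fields of characteristic 2: signs, square roots and point counts\<close>

locale finite_char2 =
  fixes F :: "'f::{field,finite} itself"
  assumes one_plus_one: "(1::'f) + 1 = 0"
begin

abbreviation "S \<equiv> (SL2 :: ('f \<times> 'f \<times> 'f \<times> 'f) monoid)"
definition q :: nat where "q = card (UNIV :: 'f set)"

text \<open>This and the following rewrite rules remove all signs, so that matrix computations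
  become identities in \<open>+\<close> alone.\<close>

lemma double [simp]: "(x::'f) + x = 0"
  using one_plus_one by (metis distrib_left mult.right_neutral mult_zero_right)

lemma two_eq_0 [simp]: "(2::'f) = 0"
  by (metis one_add_one one_plus_one)

lemma double_left [simp]: "(x::'f) + (x + y) = y"
  by (simp add: add.assoc[symmetric])

lemma uminus_eq [simp]: "- (x::'f) = x"
  using double by (metis add_eq_0_iff)

lemma minus_eq [simp]: "(x::'f) - y = x + y"
  using uminus_eq by (metis diff_conv_add_uminus)

lemma add_eq_0 [simp]: "(x::'f) + y = 0 \<longleftrightarrow> x = y"
  using minus_eq by (metis eq_iff_diff_eq_0)

lemma square_eq: "(x::'f) * x = y * y \<longleftrightarrow> x = y"
proof -
  have "(x + y) * (x + y) = x*x + y*y" using double[of "x*y"] by (simp add: algebra_simps)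
  then show ?thesis by (metis add_eq_0 mult_eq_0_iff)
qed

text \<open>The Frobenius map is injective by \<open>square_eq\<close>, hence onto, the field being
  finite.\<close>

lemma ex_sqrt: "\<exists>y. y * y = (x::'f)"
proof -
  have "inj (\<lambda>y::'f. y * y)" by (simp add: inj_def square_eq)
  then have "surj (\<lambda>y::'f. y * y)" by (simp add: finite_UNIV_inj_surj)
  then show ?thesis by (metis surjD)
qed

lemma q_ge_2: "q \<ge> 2"
proof -
  have "card {0::'f, 1} \<le> q" unfolding q_def by (intro card_mono) auto
  then show ?thesis by simp
qed

lemma card_pairs: "card (UNIV :: ('f \<times> 'f) set) = q\<^sup>2"
  by (simp add: q_def power2_eq_square flip: UNIV_Times_UNIV)

lemma card_line:
  fixes a b c :: 'f
  assumes "(a, b) \<noteq> (0, 0)"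
  shows "card {(x, y). a * x + b * y = c} = q"
proof (cases "b = 0")
  case False
  have *: "(c + a * x) / b = y" if "a * x + b * y = c" for x y
  proof -
    have "c + a * x = b * y" unfolding that[symmetric] by (simp add: add.commute)
    then show ?thesis using False by simp
  qed
  have "bij_betw (\<lambda>x. (x, (c + a * x) / b)) UNIV {(x, y). a * x + b * y = c}"
    by (rule bij_betwI[where g=fst]) (use False * in \<open>auto simp: add.left_commute\<close>)
  from bij_betw_same_card[OF this] show ?thesis unfolding q_def by (rule sym)
next
  case True
  then have a: "a \<noteq> 0" using assms by auto
  have "bij_betw (\<lambda>y. (c / a, y)) UNIV {(x, y). a * x + b * y = c}"
    by (rule bij_betwI[where g=snd]) (use True a in auto)
  from bij_betw_same_card[OF this] show ?thesis unfolding q_def by (rule sym)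
qed

lemma card_hyperbola:
  fixes c :: 'f
  assumes "c \<noteq> 0"
  shows "card {(x, y). x * y = c} = q - 1"
proof -
  have "bij_betw (\<lambda>x. (x, c / x)) (UNIV - {0}) {(x, y). x * y = c}"
    by (rule bij_betwI[where g=fst]) (use assms in \<open>auto simp: field_simps\<close>)
  from bij_betw_same_card[OF this] have "card {(x, y). x * y = c} = card (UNIV - {0::'f})" by (rule sym)
  then show ?thesis by (simp add: q_def)
qed

section \<open>The order of SL2 and its elements of square one\<close>

lemma finite_S: "finite (carrier S)" by simp

lemma order_S: "card (carrier S) = q * (q\<^sup>2 - 1)"
proof -
  \<comment> \<open>The first column \<open>(p, s)\<close> is any nonzero vector; the second column
    then runs through the affine line \<open>p * t + s * r = 1\<close>, which has \<open>q\<close>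
    points.\<close>
  have "carrier S = (\<lambda>((p, s), (t, r)). (p, r, s, t)) ` (SIGMA ps:UNIV - {(0,0)}. {(t, r). fst ps * t + snd ps * r = 1})"
    by (force simp: SL2_def det2_def image_iff mult.commute split_paired_all)
  moreover have "inj_on (\<lambda>((p, s), (t, r)). (p, r, s, t)) (A :: (('f \<times> 'f) \<times> ('f \<times> 'f)) set)" for A
    by (auto simp: inj_on_def)
  ultimately have "card (carrier S) = (\<Sum>ps\<in>UNIV - {(0,0)}. card {(t, r). fst ps * t + snd ps * r = (1::'f)})"
    by (simp add: card_image del: minus_eq)
  also have "\<dots> = (\<Sum>ps\<in>UNIV - {(0::'f,0::'f)}. q)"
    by (intro sum.cong refl card_line) (auto simp: prod_eq_iff)
  also have "\<dots> = q * (q\<^sup>2 - 1)" by (simp add: card_pairs)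
  finally show ?thesis .
qed

lemma inv_S: "(p,r,s,t) \<in> carrier S \<Longrightarrow> inv\<^bsub>S\<^esub> (p,r,s,t) = (t,r,s,p)"
  by (rule group.inv_equality[OF group_SL2]) (auto simp: SL2_def det2_def mat2_mult_def algebra_simps)

text \<open>The matrix of y |-> y + det(w, y) w for \<open>w = (u, v)\<close>; the zero vector gives
  the identity.\<close>

definition transvection :: "'f \<times> 'f \<Rightarrow> 'f \<times> 'f \<times> 'f \<times> 'f" where
  "transvection = (\<lambda>(u, v). (1 + u*v, u*u, v*v, 1 + u*v))"

text \<open>Behind this is Cayley-Hamilton: with determinant 1 in characteristic 2, the square of x
  is tr(x) x + 1, so it is 1 exactly when the trace \<open>p + t\<close> vanishes.\<close>

lemma square_one_iff:
  "(p,r,s,t) \<in> carrier S \<Longrightarrow> (p,r,s,t) \<otimes>\<^bsub>S\<^esub> (p,r,s,t) = \<one>\<^bsub>S\<^esub> \<longleftrightarrow> p = t"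
proof -
  assume x: "(p,r,s,t) \<in> carrier S"
  then have "p*t + r*s = 1" by (simp add: SL2_def det2_def)
  then have d: "p*t = 1 + r*s" by (metis add.commute double_left)
  show ?thesis
  proof
    assume "p = t" then show "(p,r,s,t) \<otimes>\<^bsub>S\<^esub> (p,r,s,t) = \<one>\<^bsub>S\<^esub>"
      using d by (simp add: SL2_def mat2_mult_def algebra_simps)
  next
    assume "(p,r,s,t) \<otimes>\<^bsub>S\<^esub> (p,r,s,t) = \<one>\<^bsub>S\<^esub>"
    then have 1: "p*p + r*s = 1" "s*r + t*t = 1" by (auto simp: SL2_def mat2_mult_def)
    then have "p*p = t*t" by (metis add.commute add_right_cancel mult.commute)
    then show "p = t" by (simp add: square_eq)
  qed
qed

text \<open>Unique square roots recover \<open>u\<close> and \<open>v\<close> from the off-diagonal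
  entries; trace zero and determinant one then force the diagonal entries to be
  \<open>1 + u * v\<close>.\<close>

lemma bij_transvection: "bij_betw transvection UNIV {x \<in> carrier S. x \<otimes>\<^bsub>S\<^esub> x = \<one>\<^bsub>S\<^esub>}"
  unfolding bij_betw_def
proof
  show "inj transvection" by (auto simp: transvection_def inj_def square_eq)
  show "range transvection = {x \<in> carrier S. x \<otimes>\<^bsub>S\<^esub> x = \<one>\<^bsub>S\<^esub>}" (is "_ = ?J")
  proof (intro equalityI subsetI)
    fix x assume "x \<in> range transvection"
    then obtain u v where [simp]: "x = (1 + u*v, u*u, v*v, 1 + u*v)" by (auto simp: transvection_def)
    have "x \<in> carrier S" by (simp add: SL2_def det2_def algebra_simps)
    then show "x \<in> ?J" by (simp add: square_one_iff)
  next
    fix x assume x: "x \<in> ?J"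
    obtain p r s t where [simp]: "x = (p,r,s,t)" by (cases x)
    have pt: "p = t" using x square_one_iff[of p r s t] by auto
    obtain u v where uv: "u * u = r" "v * v = s" using ex_sqrt by metis
    have "p * t + r * s = 1" using x by (simp add: SL2_def det2_def)
    then have "p * p + (1 + u*v) * (1 + u*v) = 0"
      unfolding uv[symmetric] pt[symmetric] by (simp add: algebra_simps)
    then have "p * p = (1 + u*v) * (1 + u*v)" by (simp only: add_eq_0)
    then have "p = 1 + u*v" by (simp only: square_eq)
    then show "x \<in> range transvection" using uv pt by (auto simp: transvection_def image_iff)
  qed
qed

text \<open>\<open>form x w\<close> is the determinant of \<open>(w, x w)\<close>, so its zeros are \<open>0\<close> and the eigenvectors of \<open>x\<close>.\<close>

definition form :: "'f \<times> 'f \<times> 'f \<times> 'f \<Rightarrow> 'f \<times> 'f \<Rightarrow> 'f" where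
  "form = (\<lambda>(p,r,s,t) (u,v). s*u*u + (p+t)*u*v + r*v*v)"

definition num_isotropic :: "'f \<times> 'f \<times> 'f \<times> 'f \<Rightarrow> nat" where
  "num_isotropic x = card {w. form x w = 0}"

text \<open>Multiplying by the transvection adds to x the rank one map y |-> det(w, x y) w, whose
  trace is det(w, x w). So the product has trace \<open>form x w + (p + t)\<close>, and
  \<open>square_one_iff\<close> applies.\<close>

lemma trace_transvection_mult:
  assumes "(p,r,s,t) \<in> carrier S"
  shows "transvection w \<otimes>\<^bsub>S\<^esub> (p,r,s,t) \<otimes>\<^bsub>S\<^esub> (transvection w \<otimes>\<^bsub>S\<^esub> (p,r,s,t)) = \<one>\<^bsub>S\<^esub>
     \<longleftrightarrow> form (p,r,s,t) w = p + t"
proof -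
  interpret group S by (rule group_SL2)
  obtain u v where [simp]: "w = (u,v)" by (cases w)
  have m: "transvection w \<otimes>\<^bsub>S\<^esub> (p,r,s,t) = ((1+u*v)*p + u*u*s, (1+u*v)*r + u*u*t, v*v*p+(1+u*v)*s, v*v*r+(1+u*v)*t)"
    by (simp add: transvection_def SL2_def mat2_mult_def)
  have "transvection w \<in> carrier S" using bij_transvection by (auto simp: bij_betw_def)
  then have "transvection w \<otimes>\<^bsub>S\<^esub> (p,r,s,t) \<in> carrier S" using assms by simp
  then have "transvection w \<otimes>\<^bsub>S\<^esub> (p,r,s,t) \<otimes>\<^bsub>S\<^esub> (transvection w \<otimes>\<^bsub>S\<^esub> (p,r,s,t)) = \<one>\<^bsub>S\<^esub>
     \<longleftrightarrow> (1+u*v)*p + u*u*s = v*v*r+(1+u*v)*t"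
    unfolding m by (rule square_one_iff)
  also have "\<dots> \<longleftrightarrow> ((1+u*v)*p + u*u*s) + (v*v*r+(1+u*v)*t) = 0" by simp
  also have "((1+u*v)*p + u*u*s) + (v*v*r+(1+u*v)*t) = form (p,r,s,t) w + (p + t)"
    by (simp add: form_def algebra_simps)
  finally show ?thesis by simp
qed

text \<open>The form is homogeneous of degree 2 and \<open>d / c\<close> is a square, so scaling
  vectors by its root carries one level set onto the other.\<close>

lemma card_form_scale:
  assumes "c \<noteq> 0" "d \<noteq> 0"
  shows "card {w. form x w = c} = card {w. form x w = d}"
proof -
  obtain p r s t where [simp]: "x = (p,r,s,t)" by (cases x)
  obtain k where k: "k * k = d / c" using ex_sqrt by metis
  have k0: "k \<noteq> 0" using k assms by auto
  have sc: "form x (k*u, k*v) = d / c * form x (u, v)" for u v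
    unfolding k[symmetric] by (simp add: form_def algebra_simps)
  have "bij_betw (\<lambda>(u, v). (k*u, k*v)) {w. form x w = c} {w. form x w = d}"
  proof (rule bij_betwI[where g="\<lambda>(u, v). (u/k, v/k)"])
    have "form x (u/k, v/k) = c" if "form x (u, v) = d" for u v
      using sc[of "u/k" "v/k"] k0 that assms by (simp add: field_simps)
    then show "(\<lambda>(u, v). (u / k, v / k)) \<in> {w. form x w = d} \<rightarrow> {w. form x w = c}" by auto
  qed (use sc assms k0 in auto)
  then show ?thesis by (rule bij_betw_same_card)
qed

text \<open>The \<open>q - 1\<close> nonzero levels are equally large and together with the
  isotropic vectors fill the plane, so \<open>num_isotropic\<close> determines every level
  set.\<close>

lemma card_form:
  assumes "c \<noteq> 0"
  shows "num_isotropic x + (q - 1) * card {w. form x w = c} = q\<^sup>2"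
proof -
  have "q\<^sup>2 = card (\<Union>d::'f. {w. form x w = d})" unfolding card_pairs[symmetric] by (rule arg_cong[where f=card]) auto
  also have "\<dots> = (\<Sum>d\<in>UNIV. card {w. form x w = d})" by (rule card_UN_disjoint) auto
  also have "\<dots> = num_isotropic x + (\<Sum>d\<in>UNIV-{0}. card {w. form x w = d})"
    by (subst sum.remove[of _ 0]) (auto simp: num_isotropic_def)
  also have "(\<Sum>d\<in>UNIV-{0}. card {w. form x w = d}) = (\<Sum>d\<in>UNIV-{0::'f}. card {w. form x w = c})"
    by (intro sum.cong refl card_form_scale) (use assms in auto)
  also have "\<dots> = (q - 1) * card {w. form x w = c}" by (simp add: q_def)
  finally show ?thesis by simp
qed

lemma num_isotropic_one: "num_isotropic \<one>\<^bsub>S\<^esub> = q\<^sup>2"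
  by (simp add: num_isotropic_def SL2_def form_def card_pairs[symmetric] split_beta UNIV_def[symmetric])

text \<open>For trace zero the mixed term vanishes and the form is the square of the linear form
  \<open>a * u + b * v\<close>, so its zeros are a line.\<close>

lemma num_isotropic_unipotent:
  assumes "(p,r,s,p) \<in> carrier S" "(p,r,s,p) \<noteq> \<one>\<^bsub>S\<^esub>"
  shows "num_isotropic (p,r,s,p) = q"
proof -
  obtain a b where ab: "a * a = s" "b * b = r" using ex_sqrt by metis
  have "(r, s) \<noteq> (0, 0)"
  proof
    assume 0: "(r, s) = (0, 0)"
    then have "p * p = 1 * 1" using assms by (simp add: SL2_def det2_def)
    then have "p = 1" by (simp only: square_eq)
    then show False using assms 0 by (simp add: SL2_def)
  qed
  then have "(a, b) \<noteq> (0, 0)" using ab by auto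
  moreover have "form (p,r,s,p) (u, v) = 0 \<longleftrightarrow> a * u + b * v = 0" for u v
  proof -
    have "form (p,r,s,p) (u, v) = (a*u)*(a*u) + (b*v)*(b*v)"
      unfolding ab[symmetric] by (simp add: form_def algebra_simps)
    then show ?thesis by (simp add: square_eq)
  qed
  ultimately have "{w. form (p,r,s,p) w = 0} = {(u, v). a * u + b * v = 0}" by auto
  then show ?thesis using card_line[of a b 0] \<open>(a, b) \<noteq> (0, 0)\<close> by (simp add: num_isotropic_def)
qed

section \<open>Isotropic vectors summed over all transvections\<close>

text \<open>Put \<open>w = (u, k)\<close> and \<open>v = (m, n)\<close>. The transvection sends x v
  to x v + det(w, x v) w, so the determinant with v changes by det(w, x v) det(v, w), a product of
  two linear forms in w.\<close>

lemma form_transvection_mult: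
  "form (transvection (u,k) \<otimes>\<^bsub>S\<^esub> (p,r,s,t)) (m,n)
     = form (p,r,s,t) (m,n) + (u * (s*m + t*n) + k * (p*m + r*n)) * (n*u + m*k)"
  by (simp add: form_def transvection_def SL2_def mat2_mult_def algebra_simps)

text \<open>For fixed \<open>v\<close> the equation for \<open>w\<close> says that a product of two
  linear forms has the constant value \<open>form x v\<close>. The solutions are the whole plane
  (\<open>v\<close> zero), a line (\<open>v\<close> an eigenvector) or a hyperbola; the right-hand
  side covers all three cases.\<close>

lemma card_form_transvection_mult:
  assumes "x \<in> carrier S"
  shows "real (card {w. form (transvection w \<otimes>\<^bsub>S\<^esub> x) v = 0})
       = (real q - 1) + (if form x v = 0 then 1 else 0) + (if v = (0,0) then real q ^ 2 - real q else 0)"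
proof -
  obtain p r s t where x: "x = (p,r,s,t)" by (cases x)
  obtain m n where v: "v = (m,n)" by (cases v)
  define z1 where "z1 = p*m + r*n"
  define z2 where "z2 = s*m + t*n"
  define c where "c = form x v"
  have c: "c = m*z2 + n*z1" by (simp add: c_def x v form_def z1_def z2_def algebra_simps)
  have set: "{w. form (transvection w \<otimes>\<^bsub>S\<^esub> x) v = 0} = {(u,k). c = (u*z2 + k*z1) * (n*u + m*k)}"
    by (auto simp: x v form_transvection_mult c_def z1_def z2_def)
  have det: "p*t + r*s = 1" using assms by (simp add: x SL2_def det2_def)
  \<comment> \<open>The adjugate of \<open>x\<close> recovers \<open>v\<close> from
    \<open>(z1, z2)\<close>, the image of \<open>v\<close>, so that image is nonzero if
    \<open>v\<close> is.\<close>
  have mn: "m = t*z1 + r*z2" "n = s*z1 + p*z2"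
  proof -
    have "t*z1 + r*z2 = (p*t + r*s)*m" by (simp add: z1_def z2_def algebra_simps)
    then show "m = t*z1 + r*z2" by (simp add: det)
    have "s*z1 + p*z2 = (p*t + r*s)*n" by (simp add: z1_def z2_def algebra_simps)
    then show "n = s*z1 + p*z2" by (simp add: det)
  qed
  consider "v = (0,0)" | "v \<noteq> (0,0)" "c = 0" | "c \<noteq> 0" by blast
  then show ?thesis
  proof cases
    case 1
    then have "c = 0" by (simp add: c v)
    moreover have "{(u,k). c = (u*z2 + k*z1) * (n*u + m*k)} = UNIV" using 1 \<open>c = 0\<close> by (auto simp: v)
    ultimately have "card {w. form (transvection w \<otimes>\<^bsub>S\<^esub> x) v = 0} = q\<^sup>2" by (simp only: set card_pairs)
    then show ?thesis using 1 \<open>c = 0\<close> by (simp add: c_def)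
  next
    case 2
    \<comment> \<open>Here \<open>v\<close> is an eigenvector, so the two linear forms are
      proportional and vanish on the same line.\<close>
    have *: "u*z2 + k*z1 = 0 \<longleftrightarrow> n*u + m*k = 0" for u k
    proof -
      have e: "m * (u*z2 + k*z1) = z1 * (n*u + m*k) + c * u" "n * (u*z2 + k*z1) = z2 * (n*u + m*k) + c * k"
        by (simp_all add: c algebra_simps)
      have "(z1, z2) \<noteq> (0,0)" using mn 2(1) by (auto simp: v)
      then show ?thesis using e 2 by (auto simp: v)
    qed
    have "{(u,k). c = (u*z2 + k*z1) * (n*u + m*k)} = {(u,k). n*u + m*k = 0}"
      using * 2 by auto
    then have "card {(u,k). c = (u*z2 + k*z1) * (n*u + m*k)} = q" using card_line[of n m 0] 2 by (auto simp: v)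
    then show ?thesis using 2 by (simp add: set flip: c_def)
  next
    case 3
    \<comment> \<open>Now \<open>v\<close> and its image are independent, with determinant
      \<open>c\<close>. So \<open>L\<close> and \<open>M\<close> are coordinates on the plane, and
      \<open>U\<close> and \<open>K\<close> invert them by Cramer's rule.\<close>
    define L where "L = (\<lambda>u k. u*z2 + k*z1)"
    define M where "M = (\<lambda>u k. n*u + m*k)"
    define U where "U = (\<lambda>x y. (m*x + z1*y) / c)"
    define K where "K = (\<lambda>x y. (n*x + z2*y) / c)"
    have "m * L u k + z1 * M u k = u * c" "n * L u k + z2 * M u k = k * c" for u k
      by (simp_all add: c L_def M_def algebra_simps)
    then have i1: "U (L u k) (M u k) = u" "K (L u k) (M u k) = k" for u k
      using 3 by (simp_all add: U_def K_def)
    have "(m*x + z1*y) * z2 + (n*x + z2*y) * z1 = x * c" "n * (m*x + z1*y) + m * (n*x + z2*y) = y * c" for x y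
      by (simp_all add: c algebra_simps)
    then have i2: "L (U x y) (K x y) = x" "M (U x y) (K x y) = y" for x y
      unfolding L_def M_def U_def K_def times_divide_eq_left times_divide_eq_right add_divide_distrib[symmetric]
      using 3 by simp_all
    have "bij_betw (\<lambda>(u,k). (L u k, M u k)) {(u,k). c = L u k * M u k} {(x,y). x*y = c}"
      by (rule bij_betwI[where g="\<lambda>(x,y). (U x y, K x y)"]) (auto simp: i1 i2)
    then have "bij_betw (\<lambda>(u,k). (L u k, M u k)) {(u,k). c = (u*z2 + k*z1) * (n*u + m*k)} {(x,y). x*y = c}"
      by (simp only: L_def M_def)
    then have "card {(u,k). c = (u*z2 + k*z1) * (n*u + m*k)} = q - 1"
      using card_hyperbola[OF 3] by (simp only: bij_betw_same_card)
    moreover have "v \<noteq> (0,0)" using 3 c by (auto simp: v)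
    ultimately show ?thesis using 3 q_ge_2 by (simp add: set of_nat_diff flip: c_def)
  qed
qed

text \<open>Count the pairs \<open>(w, v)\<close> by \<open>v\<close> first. As there are
  \<open>q\<^sup>2\<close> transvections, it follows that summation over them preserves
  \<open>num_isotropic x - q\<close>.\<close>

lemma sum_num_isotropic_transvection_mult:
  assumes "x \<in> carrier S"
  shows "(\<Sum>w\<in>UNIV. real (num_isotropic (transvection w \<otimes>\<^bsub>S\<^esub> x))) = real (num_isotropic x) + real q ^ 3 - real q"
proof -
  have "(\<Sum>w\<in>UNIV. real (num_isotropic (transvection w \<otimes>\<^bsub>S\<^esub> x)))
      = (\<Sum>w\<in>UNIV. \<Sum>v\<in>UNIV. if form (transvection w \<otimes>\<^bsub>S\<^esub> x) v = 0 then 1 else 0)"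
    by (simp add: num_isotropic_def sum.If_cases)
  also have "\<dots> = (\<Sum>v\<in>UNIV. real (card {w. form (transvection w \<otimes>\<^bsub>S\<^esub> x) v = 0}))"
    by (subst sum.swap) (simp add: sum.If_cases)
  also have "\<dots> = real q ^ 2 * (real q - 1) + real (num_isotropic x) + (real q ^ 2 - real q)"
    unfolding card_form_transvection_mult[OF assms] sum.distrib
    by (simp add: sum.If_cases num_isotropic_def card_pairs)
  finally show ?thesis by (simp add: algebra_simps power2_eq_square power3_eq_cube)
qed

section \<open>The relations between \<open>a\<close> and the Steinberg idempotent\<close>

lemma conv_sqrt_one:
  assumes "x \<in> carrier S"
  shows "conv S (sqrt_one S k) f x = k * (\<Sum>w\<in>UNIV. f (transvection w \<otimes>\<^bsub>S\<^esub> x))"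
proof -
  interpret group S by (rule group_SL2)
  let ?J = "{y \<in> carrier S. y \<otimes>\<^bsub>S\<^esub> y = \<one>\<^bsub>S\<^esub>}"
  have inv: "inv\<^bsub>S\<^esub> y = y" if "y \<in> ?J" for y using that by (simp add: inv_equality)
  have "conv S (sqrt_one S k) f x = (\<Sum>y\<in>?J. k * f (inv\<^bsub>S\<^esub> y \<otimes>\<^bsub>S\<^esub> x))"
    unfolding conv_def sqrt_one_def by (rule sum.mono_neutral_cong_right) auto
  also have "\<dots> = (\<Sum>y\<in>?J. k * f (y \<otimes>\<^bsub>S\<^esub> x))" using inv by (intro sum.cong) auto
  also have "\<dots> = (\<Sum>w\<in>UNIV. k * f (transvection w \<otimes>\<^bsub>S\<^esub> x))"
    by (rule sum.reindex_bij_betw[OF bij_transvection, symmetric])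
  finally show ?thesis by (simp add: sum_distrib_left)
qed

lemma sum_sqrt_one: "sum (sqrt_one S k) (carrier S) = k * real q ^ 2"
proof -
  interpret group S by (rule group_SL2)
  have "sum (sqrt_one S k) (carrier S) = conv S (sqrt_one S k) (\<lambda>_. 1) \<one>\<^bsub>S\<^esub>" by (simp add: conv_def)
  also have "\<dots> = k * real q ^ 2" by (subst conv_sqrt_one) (auto simp: card_pairs)
  finally show ?thesis .
qed

text \<open>\<open>(num_isotropic x - 1) / (q - 1)\<close> is the number of fixed points of \<open>x\<close> on the projective line, and the Steinberg
  character is one less; the remaining factor \<open>1 / (q\<^sup>2 - 1)\<close> is the degree divided by the group order.\<close>

definition steinberg :: "'f \<times> 'f \<times> 'f \<times> 'f \<Rightarrow> real" where
  "steinberg x = (real (num_isotropic x) - real q) / ((real q ^ 2 - 1) * (real q - 1))"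

lemma conv_sqrt_one_steinberg:
  assumes "x \<in> carrier S"
  shows "conv S (sqrt_one S (1 / real q)) steinberg x = steinberg x / real q"
proof -
  have "(\<Sum>w\<in>UNIV. steinberg (transvection w \<otimes>\<^bsub>S\<^esub> x)) = steinberg x"
    unfolding steinberg_def sum_divide_distrib[symmetric] sum_subtractf sum_num_isotropic_transvection_mult[OF assms]
    by (simp add: card_pairs power2_eq_square power3_eq_cube)
  then show ?thesis by (simp add: conv_sqrt_one[OF assms])
qed

text \<open>Up to the factor \<open>1 / q\<^sup>2\<close> the left-hand side counts the
  \<open>w\<close> with \<open>form x w = p + t\<close>. For trace zero this is
  \<open>num_isotropic x\<close>, namely \<open>q\<^sup>2\<close> at the identity and
  \<open>q\<close> elsewhere; otherwise \<open>card_form\<close> gives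
  \<open>(q\<^sup>2 - num_isotropic x) / (q - 1)\<close>. The Dirac, Steinberg and constant terms
  together fit all three values.\<close>

lemma conv_sqrt_one_sqrt_one:
  assumes "x \<in> carrier S"
  shows "conv S (sqrt_one S (1 / real q)) (sqrt_one S (1 / real q)) x
    = dirac S x + (1 / real q ^ 2 - 1) * steinberg x + (real q ^ 2 - 1) / real (card (carrier S))"
proof -
  obtain p r s t where x: "x = (p,r,s,t)" by (cases x)
  have q: "real q \<ge> 2" using q_ge_2 by simp
  then have q2': "real q ^ 2 \<noteq> 1" by (simp add: power2_eq_1_iff)
  have cS: "real (card (carrier S)) = real q * (real q ^ 2 - 1)"
    using q_ge_2 by (simp add: order_S of_nat_diff)
  have "conv S (sqrt_one S (1 / real q)) (sqrt_one S (1 / real q)) x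
      = 1 / real q * (\<Sum>w\<in>UNIV. if form x w = p + t then 1 / real q else 0)"
    unfolding conv_sqrt_one[OF assms] using trace_transvection_mult[of p r s t] assms
    by (simp add: sqrt_one_def x)
  also have "\<dots> = real (card {w. form x w = p + t}) / real q ^ 2"
    by (simp add: sum.If_cases power2_eq_square)
  finally have 1: "conv S (sqrt_one S (1 / real q)) (sqrt_one S (1 / real q)) x = real (card {w. form x w = p + t}) / real q ^ 2" .
  have 2: "(1 / real q ^ 2 - 1) * steinberg x = - (real (num_isotropic x) - real q) / (real q ^ 2 * (real q - 1))"
    unfolding steinberg_def using q q2' by (simp add: divide_simps) (simp add: algebra_simps)
  have "real (card {w. form x w = p + t}) = real q ^ 2 * dirac S x - (real (num_isotropic x) - real q) / (real q - 1) + real q"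
  proof (cases "p = t")
    case True
    then have "card {w. form x w = p + t} = num_isotropic x" by (simp add: num_isotropic_def)
    then show ?thesis using num_isotropic_one num_isotropic_unipotent[of p r s] assms True q
      by (cases "x = \<one>\<^bsub>S\<^esub>") (auto simp: dirac_def x field_simps power2_eq_square)
  next
    case False
    then have "real (num_isotropic x) + (real q - 1) * real (card {w. form x w = p + t}) = real q ^ 2"
      using arg_cong[OF card_form[of "p + t" x], of real] q_ge_2 by (simp add: of_nat_diff)
    moreover have "x \<noteq> \<one>\<^bsub>S\<^esub>" using False by (auto simp: x SL2_def)
    ultimately show ?thesis using q by (simp add: dirac_def field_simps power2_eq_square)
  qed
  then have 3: "real (card {w. form x w = p + t}) / real q ^ 2
      = (real q ^ 2 * dirac S x - (real (num_isotropic x) - real q) / (real q - 1) + real q) / real q ^ 2" by simp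
  have 4: "(real q ^ 2 - 1) / real (card (carrier S)) = 1 / real q"
    unfolding cS using q2' by simp
  have 5: "(Q\<^sup>2 * d - b / c + Q) / Q\<^sup>2 = d + - b / (Q\<^sup>2 * c) + 1 / Q" if "Q > 0" for Q b c d :: real
    using that by (simp add: diff_divide_distrib add_divide_distrib power2_eq_square mult.commute)
  show ?thesis unfolding 1 2 3 4 by (rule 5) (use q in simp)
qed

lemma sign_element_SL2: "sign_element S (2 / (real q + 1))"
proof -
  interpret group S by (rule group_SL2)
  have q: "real q \<ge> 2" using q_ge_2 by simp
  then have q2': "real q ^ 2 \<noteq> 1" by (simp add: power2_eq_1_iff)
  have cS: "real (card (carrier S)) = real q * (real q ^ 2 - 1)"
    using q_ge_2 by (simp add: order_S of_nat_diff)
  have "sign_element S (1 / real q + (1 - 1 / real q) * steinberg \<one>\<^bsub>S\<^esub> + (1 - real q) / real (card (carrier S)))"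
  proof (rule sign_elementI[OF finite_S])
    show "real q > 1" using q by simp
    show "sum (sqrt_one S (1 / real q)) (carrier S) = real q"
      using q by (simp add: sum_sqrt_one power2_eq_square)
    fix x assume x: "x \<in> carrier S"
    obtain p r s t where [simp]: "x = (p,r,s,t)" by (cases x)
    have "num_isotropic (inv\<^bsub>S\<^esub> x) = num_isotropic x" using x by (simp add: inv_S num_isotropic_def form_def add.commute)
    then show "steinberg (inv\<^bsub>S\<^esub> x) = steinberg x" by (simp add: steinberg_def)
  qed (fact conv_sqrt_one_steinberg conv_sqrt_one_sqrt_one)+
  moreover have "steinberg \<one>\<^bsub>S\<^esub> = real q / (real q ^ 2 - 1)"
  proof -
    have "steinberg \<one>\<^bsub>S\<^esub> = real q * (real q - 1) / ((real q ^ 2 - 1) * (real q - 1))"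
      by (simp add: steinberg_def num_isotropic_one algebra_simps power2_eq_square)
    then show ?thesis using q by simp
  qed
  moreover have "1 / Q + (1 - 1 / Q) * (Q / (Q^2 - 1)) + (1 - Q) / (Q * (Q^2 - 1)) = 2 / (Q + 1)"
    if "Q \<ge> 2" for Q :: real
  proof -
    have e: "Q^2 - 1 = (Q - 1) * (Q + 1)" by (simp add: algebra_simps power2_eq_square)
    show ?thesis unfolding e using that by (simp add: divide_simps) (simp add: algebra_simps power2_eq_square)
  qed
  ultimately show ?thesis using q by (simp only: cS)
qed

end

section \<open>Complex representations of finite groups\<close>

lemma mult_mat_entry:
  fixes A B :: "complex mat"
  assumes "A \<in> carrier_mat n n" "B \<in> carrier_mat n n" "i < n" "j < n"
  shows "(A * B) $$ (i,j) = (\<Sum>k<n. A $$ (i,k) * B $$ (k,j))"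
  using assms by (auto simp: scalar_prod_def lessThan_atLeast0 intro!: sum.cong)

lemma mult_mat_vec_entry:
  fixes A :: "complex mat"
  assumes "A \<in> carrier_mat n n" "v \<in> carrier_vec n" "i < n"
  shows "(A *\<^sub>v v) $ i = (\<Sum>k<n. A $$ (i,k) * v $ k)"
  using assms by (auto simp: scalar_prod_def lessThan_atLeast0 intro!: sum.cong)

lemma mat_eq_on_vecI:
  fixes A B :: "complex mat"
  assumes A: "A \<in> carrier_mat n n" and B: "B \<in> carrier_mat n n"
    and eq: "\<And>v. v \<in> carrier_vec n \<Longrightarrow> A *\<^sub>v v = B *\<^sub>v v"
  shows "A = B"
proof (rule eq_matI)
  fix i j assume ij: "i < dim_row B" "j < dim_col B"
  have unit: "(C *\<^sub>v unit_vec n j) $ i = C $$ (i,j)" if "C \<in> carrier_mat n n" for C :: "complex mat"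
  proof -
    have "(C *\<^sub>v unit_vec n j) $ i = (\<Sum>k<n. C $$ (i,k) * unit_vec n j $ k)"
      using mult_mat_vec_entry[OF that, of "unit_vec n j" i] ij B by simp
    also have "\<dots> = (\<Sum>k<n. if k = j then C $$ (i,j) else 0)"
      using ij B by (intro sum.cong) auto
    finally show ?thesis using ij B by simp
  qed
  show "A $$ (i,j) = B $$ (i,j)" using eq[of "unit_vec n j"] unit[OF A] unit[OF B] by simp
qed (use A B in auto)

definition trace_mat :: "complex mat \<Rightarrow> complex" where
  "trace_mat A = (\<Sum>i<dim_row A. A $$ (i,i))"

lemma trace_mat_comm:
  assumes "A \<in> carrier_mat n n" "B \<in> carrier_mat n n"
  shows "trace_mat (A * B) = trace_mat (B * A)"
proof -
  have "trace_mat (A * B) = (\<Sum>i<n. \<Sum>k<n. A $$ (i,k) * B $$ (k,i))"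
    using assms by (simp add: trace_mat_def mult_mat_entry[OF assms] del: index_mult_mat(1))
  also have "\<dots> = (\<Sum>k<n. \<Sum>i<n. B $$ (k,i) * A $$ (i,k))"
    by (subst sum.swap) (simp add: mult.commute)
  also have "\<dots> = trace_mat (B * A)"
    using assms by (simp add: trace_mat_def mult_mat_entry[OF assms(2,1)] del: index_mult_mat(1))
  finally show ?thesis .
qed

definition mat_sum :: "nat \<Rightarrow> 'a set \<Rightarrow> ('a \<Rightarrow> complex mat) \<Rightarrow> complex mat" where
  "mat_sum n A f = mat n n (\<lambda>ij. \<Sum>x\<in>A. f x $$ ij)"

lemma mat_sum_carrier [simp]: "mat_sum n A f \<in> carrier_mat n n"
  by (simp add: mat_sum_def)

lemma dim_mat_sum [simp]: "dim_row (mat_sum n A f) = n" "dim_col (mat_sum n A f) = n"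
  by (simp_all add: mat_sum_def)

lemma mat_sum_entry: "i < n \<Longrightarrow> j < n \<Longrightarrow> mat_sum n A f $$ (i,j) = (\<Sum>x\<in>A. f x $$ (i,j))"
  by (simp add: mat_sum_def)

lemma mat_sum_cong: "(\<And>x. x \<in> A \<Longrightarrow> f x = g x) \<Longrightarrow> mat_sum n A f = mat_sum n A g"
  by (simp add: mat_sum_def cong: sum.cong)

lemma mult_mat_sum:
  assumes "M \<in> carrier_mat n n" "\<And>x. x \<in> A \<Longrightarrow> f x \<in> carrier_mat n n"
  shows "M * mat_sum n A f = mat_sum n A (\<lambda>x. M * f x)"
proof (rule eq_matI)
  fix i j assume "i < dim_row (mat_sum n A (\<lambda>x. M * f x))" "j < dim_col (mat_sum n A (\<lambda>x. M * f x))"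
  then have ij: "i < n" "j < n" by (simp_all add: mat_sum_def)
  have "(M * mat_sum n A f) $$ (i,j) = (\<Sum>k<n. \<Sum>x\<in>A. M $$ (i,k) * f x $$ (k,j))"
    using ij by (subst mult_mat_entry[OF assms(1) mat_sum_carrier]) (auto simp: mat_sum_entry sum_distrib_left)
  also have "\<dots> = (\<Sum>x\<in>A. (M * f x) $$ (i,j))"
    by (subst sum.swap) (intro sum.cong refl mult_mat_entry[symmetric], use assms ij in auto)
  finally show "(M * mat_sum n A f) $$ (i,j) = mat_sum n A (\<lambda>x. M * f x) $$ (i,j)"
    using ij by (simp add: mat_sum_entry)
qed (use assms in \<open>auto simp: mat_sum_def\<close>)

lemma mat_sum_mult:
  assumes "M \<in> carrier_mat n n" "\<And>x. x \<in> A \<Longrightarrow> f x \<in> carrier_mat n n"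
  shows "mat_sum n A f * M = mat_sum n A (\<lambda>x. f x * M)"
proof (rule eq_matI)
  fix i j assume "i < dim_row (mat_sum n A (\<lambda>x. f x * M))" "j < dim_col (mat_sum n A (\<lambda>x. f x * M))"
  then have ij: "i < n" "j < n" by (simp_all add: mat_sum_def)
  have "(mat_sum n A f * M) $$ (i,j) = (\<Sum>k<n. \<Sum>x\<in>A. f x $$ (i,k) * M $$ (k,j))"
    using ij by (subst mult_mat_entry[OF mat_sum_carrier assms(1)]) (auto simp: mat_sum_entry sum_distrib_right)
  also have "\<dots> = (\<Sum>x\<in>A. (f x * M) $$ (i,j))"
    by (subst sum.swap) (intro sum.cong refl mult_mat_entry[symmetric], use assms ij in auto)
  finally show "(mat_sum n A f * M) $$ (i,j) = mat_sum n A (\<lambda>x. f x * M) $$ (i,j)"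
    using ij by (simp add: mat_sum_entry)
qed (use assms in \<open>auto simp: mat_sum_def\<close>)

definition dagger :: "complex mat \<Rightarrow> complex mat" where
  "dagger A = mat (dim_col A) (dim_row A) (\<lambda>(i,j). cnj (A $$ (j,i)))"

lemma dagger_carrier [simp]: "A \<in> carrier_mat n n \<Longrightarrow> dagger A \<in> carrier_mat n n"
  by (simp add: dagger_def)

lemma dim_dagger [simp]: "dim_row (dagger A) = dim_col A" "dim_col (dagger A) = dim_row A"
  by (simp_all add: dagger_def)

lemma dagger_entry: "A \<in> carrier_mat n n \<Longrightarrow> i < n \<Longrightarrow> j < n \<Longrightarrow> dagger A $$ (i,j) = cnj (A $$ (j,i))"
  by (auto simp: dagger_def)

lemma dagger_mult:
  assumes "A \<in> carrier_mat n n" "B \<in> carrier_mat n n"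
  shows "dagger (A * B) = dagger B * dagger A"
proof (rule eq_matI)
  fix i j assume "i < dim_row (dagger B * dagger A)" "j < dim_col (dagger B * dagger A)"
  then have ij: "i < n" "j < n" using assms by (simp_all add: dagger_def)
  have AB: "A * B \<in> carrier_mat n n" using assms by simp
  show "dagger (A * B) $$ (i,j) = (dagger B * dagger A) $$ (i,j)"
    unfolding dagger_entry[OF AB ij] mult_mat_entry[OF assms ij(2,1)]
      mult_mat_entry[OF dagger_carrier[OF assms(2)] dagger_carrier[OF assms(1)] ij]
    using ij by (simp add: dagger_entry[OF assms(1)] dagger_entry[OF assms(2)] mult.commute)
qed (use assms in \<open>auto simp: dagger_def\<close>)

definition cinner :: "complex vec \<Rightarrow> complex vec \<Rightarrow> complex" where
  "cinner u v = (\<Sum>i<dim_vec v. cnj (u $ i) * v $ i)"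

lemma cinner_dagger:
  assumes "A \<in> carrier_mat n n" "u \<in> carrier_vec n" "v \<in> carrier_vec n"
  shows "cinner u (dagger A *\<^sub>v v) = cinner (A *\<^sub>v u) v"
proof -
  have "cinner u (dagger A *\<^sub>v v) = (\<Sum>i<n. \<Sum>k<n. cnj (u $ i) * (cnj (A $$ (k,i)) * v $ k))"
    using assms by (auto simp: cinner_def mult_mat_vec_entry[of "dagger A" n] dagger_entry[OF assms(1)] sum_distrib_left
      simp del: index_mult_mat_vec intro!: sum.cong)
  also have "\<dots> = (\<Sum>k<n. \<Sum>i<n. cnj (u $ i) * (cnj (A $$ (k,i)) * v $ k))" by (rule sum.swap)
  also have "\<dots> = (\<Sum>k<n. cnj ((A *\<^sub>v u) $ k) * v $ k)"
    using assms by (intro sum.cong refl) (simp add: mult_mat_vec_entry[OF assms(1,2)] sum_distrib_left mult_ac del: index_mult_mat_vec)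
  also have "\<dots> = cinner (A *\<^sub>v u) v" using assms by (simp add: cinner_def)
  finally show ?thesis .
qed

lemma cinner_self: "cinner u u = complex_of_real (\<Sum>i<dim_vec u. (cmod (u $ i))\<^sup>2)"
  by (simp add: cinner_def complex_norm_square mult.commute del: of_real_power)

section \<open>The group algebra acting on a representation, and an invariant inner product\<close>

definition rep_sum :: "('g, 'b) monoid_scheme \<Rightarrow> nat \<Rightarrow> ('g \<Rightarrow> complex mat) \<Rightarrow> ('g \<Rightarrow> real) \<Rightarrow> complex mat" where
  "rep_sum G n \<rho> h = mat_sum n (carrier G) (\<lambda>x. complex_of_real (h x) \<cdot>\<^sub>m \<rho> x)"

lemma rep_sum_carrier [simp]: "rep_sum G n \<rho> h \<in> carrier_mat n n"
  by (simp add: rep_sum_def)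

lemma dim_rep_sum [simp]: "dim_row (rep_sum G n \<rho> h) = n" "dim_col (rep_sum G n \<rho> h) = n"
  by (simp_all add: rep_sum_def)

lemma rep_sum_cong:
  "(\<And>x. x \<in> carrier G \<Longrightarrow> f x = g x) \<Longrightarrow> rep_sum G n \<rho> f = rep_sum G n \<rho> g"
  by (simp add: rep_sum_def cong: mat_sum_cong)

locale finite_group_rep = group G for G :: "('g, 'b) monoid_scheme" (structure) +
  fixes n :: nat and \<rho> :: "'g \<Rightarrow> complex mat"
  assumes fin: "finite (carrier G)" and rep: "complex_rep G n \<rho>"
begin

lemma rho_carrier [simp]: "x \<in> carrier G \<Longrightarrow> \<rho> x \<in> carrier_mat n n"
  using rep by (simp add: complex_rep_def)

lemma dim_rho [simp]: "x \<in> carrier G \<Longrightarrow> dim_row (\<rho> x) = n" "x \<in> carrier G \<Longrightarrow> dim_col (\<rho> x) = n"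
  using rho_carrier by blast+

lemma rho_mult: "x \<in> carrier G \<Longrightarrow> y \<in> carrier G \<Longrightarrow> \<rho> (x \<otimes> y) = \<rho> x * \<rho> y"
  using rep by (simp add: complex_rep_def)

lemma rho_one: "\<rho> \<one> = 1\<^sub>m n"
  using rep by (simp add: complex_rep_def)

lemma rep_sum_entry:
  assumes "i < n" "j < n"
  shows "rep_sum G n \<rho> h $$ (i,j) = (\<Sum>x\<in>carrier G. complex_of_real (h x) * \<rho> x $$ (i,j))"
  unfolding rep_sum_def mat_sum_entry[OF assms]
proof (rule sum.cong[OF refl])
  fix x assume "x \<in> carrier G"
  then show "(complex_of_real (h x) \<cdot>\<^sub>m \<rho> x) $$ (i,j) = complex_of_real (h x) * \<rho> x $$ (i,j)"
    using rho_carrier[of x] assms by auto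
qed

lemma rep_sum_dirac: "rep_sum G n \<rho> (dirac G) = 1\<^sub>m n"
proof (rule eq_matI)
  fix i j assume "i < dim_row (1\<^sub>m n :: complex mat)" "j < dim_col (1\<^sub>m n :: complex mat)"
  then have ij: "i < n" "j < n" by simp_all
  have "rep_sum G n \<rho> (dirac G) $$ (i,j) = (\<Sum>x\<in>carrier G. if x = \<one> then \<rho> x $$ (i,j) else 0)"
    unfolding rep_sum_entry[OF ij] by (intro sum.cong) (auto simp: dirac_def)
  then show "rep_sum G n \<rho> (dirac G) $$ (i,j) = 1\<^sub>m n $$ (i,j)" using fin by (simp add: rho_one)
qed simp_all

text \<open>The linear extension of a representation to the group algebra is multiplicative, which
  turns the relations of \<open>sign_element\<close> into matrix identities.\<close>

lemma rep_sum_conv: "rep_sum G n \<rho> (conv G f g) = rep_sum G n \<rho> f * rep_sum G n \<rho> g"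
proof (rule eq_matI)
  have c: "rep_sum G n \<rho> h \<in> carrier_mat n n" for h by simp
  fix i j assume "i < dim_row (rep_sum G n \<rho> f * rep_sum G n \<rho> g)" "j < dim_col (rep_sum G n \<rho> f * rep_sum G n \<rho> g)"
  then have ij: "i < n" "j < n" using c[of f] c[of g] by auto
  have "(rep_sum G n \<rho> f * rep_sum G n \<rho> g) $$ (i,j)
     = (\<Sum>k<n. (\<Sum>y\<in>carrier G. f y * \<rho> y $$ (i,k)) * (\<Sum>z\<in>carrier G. g z * \<rho> z $$ (k,j)))"
    unfolding mult_mat_entry[OF c c ij] using ij by (intro sum.cong refl) (simp add: rep_sum_entry)
  also have "\<dots> = (\<Sum>k<n. \<Sum>y\<in>carrier G. \<Sum>z\<in>carrier G. f y * g z * (\<rho> y $$ (i,k) * \<rho> z $$ (k,j)))"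
    by (simp add: sum_product mult_ac)
  also have "\<dots> = (\<Sum>y\<in>carrier G. \<Sum>k<n. \<Sum>z\<in>carrier G. f y * g z * (\<rho> y $$ (i,k) * \<rho> z $$ (k,j)))"
    by (rule sum.swap)
  also have "\<dots> = (\<Sum>y\<in>carrier G. \<Sum>z\<in>carrier G. \<Sum>k<n. f y * g z * (\<rho> y $$ (i,k) * \<rho> z $$ (k,j)))"
    by (intro sum.cong refl sum.swap)
  also have "\<dots> = (\<Sum>y\<in>carrier G. \<Sum>z\<in>carrier G. f y * g z * \<rho> (y \<otimes> z) $$ (i,j))"
  proof (intro sum.cong refl)
    fix y z assume "y \<in> carrier G" "z \<in> carrier G"
    then show "(\<Sum>k<n. f y * g z * (\<rho> y $$ (i,k) * \<rho> z $$ (k,j))) = f y * g z * \<rho> (y \<otimes> z) $$ (i,j)"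
      using ij by (simp add: rho_mult mult_mat_entry[of "\<rho> y" n "\<rho> z"] sum_distrib_left del: index_mult_mat(1))
  qed
  also have "\<dots> = (\<Sum>y\<in>carrier G. \<Sum>x\<in>carrier G. f y * g (inv y \<otimes> x) * \<rho> x $$ (i,j))"
  proof (rule sum.cong[OF refl])
    fix y assume y: "y \<in> carrier G"
    show "(\<Sum>z\<in>carrier G. f y * g z * \<rho> (y \<otimes> z) $$ (i,j)) = (\<Sum>x\<in>carrier G. f y * g (inv y \<otimes> x) * \<rho> x $$ (i,j))"
      unfolding sum_translate[OF y, symmetric, of "\<lambda>z. f y * g z * \<rho> (y \<otimes> z) $$ (i,j)"]
      using y by (intro sum.cong refl) (simp add: mult_inv_cancel)
  qed
  also have "\<dots> = (\<Sum>x\<in>carrier G. \<Sum>y\<in>carrier G. f y * g (inv y \<otimes> x) * \<rho> x $$ (i,j))"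
    by (rule sum.swap)
  also have "\<dots> = rep_sum G n \<rho> (conv G f g) $$ (i,j)"
    unfolding rep_sum_entry[OF ij] conv_def by (simp add: sum_distrib_right)
  finally show "rep_sum G n \<rho> (conv G f g) $$ (i,j) = (rep_sum G n \<rho> f * rep_sum G n \<rho> g) $$ (i,j)" by simp
qed simp_all

text \<open>The Gram matrix of an invariant inner product, obtained by averaging.\<close>

definition gram :: "complex mat" where
  "gram = mat_sum n (carrier G) (\<lambda>g. dagger (\<rho> g) * \<rho> g)"

lemma gram_carrier [simp]: "gram \<in> carrier_mat n n"
  by (simp add: gram_def)

lemma dim_gram [simp]: "dim_row gram = n" "dim_col gram = n"
  by (simp_all add: gram_def)

text \<open>The averaging sum is unchanged by right translation. In terms of the inner product,
  \<open>\<rho> (inv h)\<close> is the adjoint of \<open>\<rho> h\<close>.\<close>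

lemma dagger_rho_mult_gram:
  assumes h: "h \<in> carrier G"
  shows "dagger (\<rho> h) * gram = gram * \<rho> (inv h)"
proof -
  have c: "dagger (\<rho> g) * \<rho> g \<in> carrier_mat n n" if "g \<in> carrier G" for g
    using that by (intro mult_carrier_mat[of _ n n]) auto
  have "dagger (\<rho> h) * gram = mat_sum n (carrier G) (\<lambda>g. dagger (\<rho> h) * (dagger (\<rho> g) * \<rho> g))"
    unfolding gram_def using h c by (intro mult_mat_sum) auto
  also have "\<dots> = mat_sum n (carrier G) (\<lambda>g. dagger (\<rho> (g \<otimes> h)) * \<rho> g)"
    using h by (intro mat_sum_cong) (simp add: rho_mult dagger_mult[of _ n] assoc_mult_mat[of _ n n _ n _ n])
  also have "\<dots> = mat_sum n (carrier G) (\<lambda>g. dagger (\<rho> g) * \<rho> (g \<otimes> inv h))"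
    unfolding mat_sum_def using h
    by (intro arg_cong[where f="mat n n"] ext sum.reindex_bij_witness[where i="\<lambda>g. g \<otimes> inv h" and j="\<lambda>g. g \<otimes> h"])
       (auto simp: m_assoc)
  also have "\<dots> = mat_sum n (carrier G) (\<lambda>g. dagger (\<rho> g) * \<rho> g * \<rho> (inv h))"
    using h by (intro mat_sum_cong) (simp add: rho_mult assoc_mult_mat[of _ n n _ n _ n])
  also have "\<dots> = gram * \<rho> (inv h)"
    unfolding gram_def using h c by (intro mat_sum_mult[symmetric]) auto
  finally show ?thesis .
qed

lemma cinner_gram:
  assumes v: "v \<in> carrier_vec n"
  shows "cinner v (gram *\<^sub>v v) = complex_of_real (\<Sum>g\<in>carrier G. \<Sum>i<n. (cmod ((\<rho> g *\<^sub>v v) $ i))\<^sup>2)"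
proof -
  have c: "dagger (\<rho> g) * \<rho> g \<in> carrier_mat n n" if "g \<in> carrier G" for g
    using that by (intro mult_carrier_mat[of _ n n]) auto
  have "cinner v (gram *\<^sub>v v) = (\<Sum>i<n. \<Sum>k<n. cnj (v $ i) * (gram $$ (i,k) * v $ k))"
    by (simp add: cinner_def mult_mat_vec_entry[OF gram_carrier v] sum_distrib_left del: index_mult_mat_vec)
  also have "\<dots> = (\<Sum>i<n. \<Sum>k<n. \<Sum>g\<in>carrier G. cnj (v $ i) * ((dagger (\<rho> g) * \<rho> g) $$ (i,k) * v $ k))"
    by (intro sum.cong refl) (simp add: gram_def mat_sum_entry sum_distrib_left sum_distrib_right del: index_mult_mat(1))
  also have "\<dots> = (\<Sum>i<n. \<Sum>g\<in>carrier G. \<Sum>k<n. cnj (v $ i) * ((dagger (\<rho> g) * \<rho> g) $$ (i,k) * v $ k))"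
    by (intro sum.cong refl sum.swap)
  also have "\<dots> = (\<Sum>g\<in>carrier G. \<Sum>i<n. \<Sum>k<n. cnj (v $ i) * ((dagger (\<rho> g) * \<rho> g) $$ (i,k) * v $ k))"
    by (rule sum.swap)
  also have "\<dots> = (\<Sum>g\<in>carrier G. cinner v ((dagger (\<rho> g) * \<rho> g) *\<^sub>v v))"
  proof (intro sum.cong refl)
    fix g assume g: "g \<in> carrier G"
    have "dim_vec ((dagger (\<rho> g) * \<rho> g) *\<^sub>v v) = n" using c[OF g] by auto
    then show "(\<Sum>i<n. \<Sum>k<n. cnj (v $ i) * ((dagger (\<rho> g) * \<rho> g) $$ (i,k) * v $ k)) = cinner v ((dagger (\<rho> g) * \<rho> g) *\<^sub>v v)"
      by (simp add: cinner_def mult_mat_vec_entry[OF c[OF g] v] sum_distrib_left del: index_mult_mat_vec index_mult_mat(1))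
  qed
  also have "\<dots> = (\<Sum>g\<in>carrier G. cinner (\<rho> g *\<^sub>v v) (\<rho> g *\<^sub>v v))"
  proof (intro sum.cong refl)
    fix g assume g: "g \<in> carrier G"
    then have gv: "\<rho> g *\<^sub>v v \<in> carrier_vec n" using v by (metis mult_mat_vec_carrier rho_carrier)
    have "(dagger (\<rho> g) * \<rho> g) *\<^sub>v v = dagger (\<rho> g) *\<^sub>v (\<rho> g *\<^sub>v v)"
      using g v by (intro assoc_mult_mat_vec[of _ n n _ n]) auto
    then show "cinner v ((dagger (\<rho> g) * \<rho> g) *\<^sub>v v) = cinner (\<rho> g *\<^sub>v v) (\<rho> g *\<^sub>v v)"
      using cinner_dagger[OF rho_carrier[OF g] v gv] by simp
  qed
  also have "\<dots> = (\<Sum>g\<in>carrier G. complex_of_real (\<Sum>i<n. (cmod ((\<rho> g *\<^sub>v v) $ i))\<^sup>2))"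
  proof (intro sum.cong refl)
    fix g assume g: "g \<in> carrier G"
    then have "dim_vec (\<rho> g *\<^sub>v v) = n" using rho_carrier[OF g] by auto
    then show "cinner (\<rho> g *\<^sub>v v) (\<rho> g *\<^sub>v v) = complex_of_real (\<Sum>i<n. (cmod ((\<rho> g *\<^sub>v v) $ i))\<^sup>2)"
      by (simp only: cinner_self)
  qed
  finally show ?thesis by simp
qed

lemma cinner_gram_nonneg:
  assumes "v \<in> carrier_vec n"
  obtains r where "r \<ge> 0" "cinner v (gram *\<^sub>v v) = complex_of_real r"
  by (rule that[OF _ cinner_gram[OF assms]]) (intro sum_nonneg zero_le_power2)

text \<open>All terms of \<open>cinner_gram\<close> are nonnegative, and the one at the identity is
  the ordinary squared length of \<open>v\<close>.\<close>

lemma cinner_gram_pos: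
  assumes v: "v \<in> carrier_vec n" and nz: "v \<noteq> 0\<^sub>v n"
  obtains r where "r > 0" "cinner v (gram *\<^sub>v v) = complex_of_real r"
proof (rule that[OF _ cinner_gram[OF v]])
  obtain i where i: "i < n" "v $ i \<noteq> 0" using v nz by (metis carrier_vecD eq_vecI index_zero_vec(1) index_zero_vec(2))
  have "(cmod (v $ i))\<^sup>2 \<le> (\<Sum>j<n. (cmod (v $ j))\<^sup>2)" using i by (intro member_le_sum) auto
  then have "0 < (\<Sum>j<n. (cmod (v $ j))\<^sup>2)" using i by (smt (verit) zero_less_norm_iff zero_less_power)
  also have "\<dots> = (\<Sum>j<n. (cmod ((\<rho> \<one> *\<^sub>v v) $ j))\<^sup>2)" using v by (simp add: rho_one)
  also have "\<dots> \<le> (\<Sum>g\<in>carrier G. \<Sum>i<n. (cmod ((\<rho> g *\<^sub>v v) $ i))\<^sup>2)"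
    using fin by (intro member_le_sum[of \<one> "carrier G" "\<lambda>g. \<Sum>i<n. (cmod ((\<rho> g *\<^sub>v v) $ i))\<^sup>2"]) (auto intro: sum_nonneg)
  finally show "0 < (\<Sum>g\<in>carrier G. \<Sum>i<n. (cmod ((\<rho> g *\<^sub>v v) $ i))\<^sup>2)" .
qed

lemma gram_inverse: obtains K where "K \<in> carrier_mat n n" "K * gram = 1\<^sub>m n" "gram * K = 1\<^sub>m n"
proof -
  have "det gram \<noteq> 0"
  proof
    assume "det gram = 0"
    then obtain v where v: "v \<in> carrier_vec n" "v \<noteq> 0\<^sub>v n" "gram *\<^sub>v v = 0\<^sub>v n"
      using det_0_iff_vec_prod_zero_field[OF gram_carrier] by auto
    obtain r where "r > 0" "cinner v (gram *\<^sub>v v) = complex_of_real r" by (rule cinner_gram_pos[OF v(1,2)])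
    then show False using v by (simp add: cinner_def)
  qed
  from det_non_zero_imp_unit[OF gram_carrier this, of "()"] show ?thesis
    using that by (auto simp: Units_def ring_mat_def)
qed

text \<open>\<open>gram\<close> conjugates \<open>\<rho> (inv g)\<close> into the conjugate
  transpose of \<open>\<rho> g\<close>, and the trace is invariant under similarity.\<close>

lemma trace_rho_inv:
  assumes g: "g \<in> carrier G"
  shows "trace_mat (\<rho> (inv g)) = cnj (trace_mat (\<rho> g))"
proof -
  obtain K where K: "K \<in> carrier_mat n n" "K * gram = 1\<^sub>m n" "gram * K = 1\<^sub>m n" by (rule gram_inverse)
  have d: "dagger (\<rho> g) \<in> carrier_mat n n" "\<rho> (inv g) \<in> carrier_mat n n" using g by auto
  have "dagger (\<rho> g) = (dagger (\<rho> g) * gram) * K"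
    using d K by (simp add: assoc_mult_mat[of _ n n _ n _ n] right_mult_one_mat[OF d(1)])
  also have "\<dots> = gram * (\<rho> (inv g) * K)"
    using d K g by (simp add: dagger_rho_mult_gram assoc_mult_mat[of _ n n _ n _ n])
  finally have "trace_mat (dagger (\<rho> g)) = trace_mat ((\<rho> (inv g) * K) * gram)"
    using d K by (simp add: trace_mat_comm[of gram n])
  also have "(\<rho> (inv g) * K) * gram = \<rho> (inv g)"
    using d K by (simp add: assoc_mult_mat[of _ n n _ n _ n])
  finally have "trace_mat (\<rho> (inv g)) = trace_mat (dagger (\<rho> g))" by simp
  also have "\<dots> = cnj (trace_mat (\<rho> g))"
    using rho_carrier[OF g] by (auto simp: trace_mat_def dagger_def)
  finally show ?thesis .
qed

text \<open>Self-adjointness for the invariant inner product: taking adjoints replaces each x by its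
  inverse, which does not affect the real coefficients \<open>c\<close>.\<close>

lemma dagger_rep_sum_mult_gram:
  assumes "\<And>x. x \<in> carrier G \<Longrightarrow> c (inv x) = c x"
  shows "dagger (rep_sum G n \<rho> c) * gram = gram * rep_sum G n \<rho> c"
proof -
  have "dagger (rep_sum G n \<rho> c) = mat_sum n (carrier G) (\<lambda>x. complex_of_real (c x) \<cdot>\<^sub>m dagger (\<rho> x))"
  proof (rule eq_matI)
    fix i j assume "i < dim_row (mat_sum n (carrier G) (\<lambda>x. complex_of_real (c x) \<cdot>\<^sub>m dagger (\<rho> x)))"
      "j < dim_col (mat_sum n (carrier G) (\<lambda>x. complex_of_real (c x) \<cdot>\<^sub>m dagger (\<rho> x)))"
    then have ij: "i < n" "j < n" by (simp_all add: mat_sum_def)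
    show "dagger (rep_sum G n \<rho> c) $$ (i,j) = mat_sum n (carrier G) (\<lambda>x. complex_of_real (c x) \<cdot>\<^sub>m dagger (\<rho> x)) $$ (i,j)"
      unfolding dagger_entry[OF rep_sum_carrier ij] rep_sum_entry[OF ij(2,1)] mat_sum_entry[OF ij] cnj_sum
    proof (rule sum.cong[OF refl])
      fix x assume x: "x \<in> carrier G"
      have "dim_row (dagger (\<rho> x)) = n" "dim_col (dagger (\<rho> x)) = n" using dagger_carrier[OF rho_carrier[OF x]] by auto
      then show "cnj (complex_of_real (c x) * \<rho> x $$ (j,i)) = (complex_of_real (c x) \<cdot>\<^sub>m dagger (\<rho> x)) $$ (i,j)"
        using ij by (simp add: dagger_entry[OF rho_carrier[OF x] ij])
    qed
  qed simp_all
  then have "dagger (rep_sum G n \<rho> c) * gram = mat_sum n (carrier G) (\<lambda>x. (complex_of_real (c x) \<cdot>\<^sub>m dagger (\<rho> x)) * gram)"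
    by (simp add: mat_sum_mult)
  also have "\<dots> = mat_sum n (carrier G) (\<lambda>x. complex_of_real (c (inv x)) \<cdot>\<^sub>m (gram * \<rho> (inv x)))"
  proof (rule mat_sum_cong)
    fix x assume x: "x \<in> carrier G"
    show "(complex_of_real (c x) \<cdot>\<^sub>m dagger (\<rho> x)) * gram = complex_of_real (c (inv x)) \<cdot>\<^sub>m (gram * \<rho> (inv x))"
      using mult_smult_assoc_mat[OF dagger_carrier[OF rho_carrier[OF x]] gram_carrier] x
      by (simp add: assms dagger_rho_mult_gram)
  qed
  also have "\<dots> = mat_sum n (carrier G) (\<lambda>x. complex_of_real (c x) \<cdot>\<^sub>m (gram * \<rho> x))"
    unfolding mat_sum_def by (intro arg_cong[where f="mat n n"] ext sum_inverse[of "\<lambda>x. (complex_of_real (c x) \<cdot>\<^sub>m (gram * \<rho> x)) $$ ij" for ij])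
  also have "\<dots> = mat_sum n (carrier G) (\<lambda>x. gram * (complex_of_real (c x) \<cdot>\<^sub>m \<rho> x))"
    by (rule mat_sum_cong) (simp add: mult_smult_distrib[OF gram_carrier rho_carrier])
  also have "\<dots> = gram * rep_sum G n \<rho> c"
    unfolding rep_sum_def by (rule mult_mat_sum[symmetric]) auto
  finally show ?thesis .
qed

text \<open>For a self-adjoint C, \<beta> times the squared length of \<open>v\<close> is the
  squared length of C v, both lengths taken with respect to \<open>gram\<close>.\<close>

lemma eigenvalue_rep_sum_square_nonneg:
  assumes c: "\<And>x. x \<in> carrier G \<Longrightarrow> c (inv x) = c x"
    and v: "v \<in> carrier_vec n" "v \<noteq> 0\<^sub>v n"
    and ev: "(rep_sum G n \<rho> c * rep_sum G n \<rho> c) *\<^sub>v v = \<beta> \<cdot>\<^sub>v v"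
  shows "\<exists>r\<ge>0. \<beta> = complex_of_real r"
proof -
  let ?C = "rep_sum G n \<rho> c"
  have C: "?C \<in> carrier_mat n n" by simp
  have dgram: "dagger ?C * gram = gram * ?C" by (rule dagger_rep_sum_mult_gram) (rule c)
  have Cv: "?C *\<^sub>v v \<in> carrier_vec n" using C v by (metis mult_mat_vec_carrier)
  obtain r where r: "r > 0" "cinner v (gram *\<^sub>v v) = complex_of_real r" by (rule cinner_gram_pos[OF v])
  obtain s where s: "s \<ge> 0" "cinner (?C *\<^sub>v v) (gram *\<^sub>v (?C *\<^sub>v v)) = complex_of_real s" by (rule cinner_gram_nonneg[OF Cv])
  have HCv: "gram *\<^sub>v (?C *\<^sub>v v) \<in> carrier_vec n" using Cv by (metis gram_carrier mult_mat_vec_carrier)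
  have "complex_of_real s = cinner v (dagger ?C *\<^sub>v (gram *\<^sub>v (?C *\<^sub>v v)))"
    using cinner_dagger[OF C v(1) HCv] s by simp
  also have "dagger ?C *\<^sub>v (gram *\<^sub>v (?C *\<^sub>v v)) = (dagger ?C * gram) *\<^sub>v (?C *\<^sub>v v)"
    using C Cv by (intro assoc_mult_mat_vec[symmetric, of _ n n _ n]) auto
  also have "\<dots> = gram *\<^sub>v ((?C * ?C) *\<^sub>v v)"
    unfolding dgram using C Cv v(1) by (simp add: assoc_mult_mat_vec[of _ n n _ n])
  also have "\<dots> = \<beta> \<cdot>\<^sub>v (gram *\<^sub>v v)" unfolding ev using v(1) by (rule mult_mat_vec[OF gram_carrier])
  also have "cinner v (\<beta> \<cdot>\<^sub>v (gram *\<^sub>v v)) = \<beta> * cinner v (gram *\<^sub>v v)"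
    by (simp add: cinner_def sum_distrib_left mult_ac)
  finally have "\<beta> = complex_of_real (s / r)" using r by (simp add: field_simps)
  then show ?thesis using r s by (intro exI[of _ "s / r"]) auto
qed

end

section \<open>Schur's lemma and character orthogonality\<close>

lemma scalar_mat_mult_vec:
  fixes v :: "complex vec"
  assumes "v \<in> carrier_vec n"
  shows "(\<mu> \<cdot>\<^sub>m 1\<^sub>m n) *\<^sub>v v = \<mu> \<cdot>\<^sub>v v"
  using assms by auto

text \<open>Over the complex numbers \<open>M\<close> has an eigenvalue; its eigenspace is nonzero
  and invariant, hence everything.\<close>

lemma schur_scalar:
  assumes irr: "irreducible_rep G n \<rho>" and M: "M \<in> carrier_mat n n"
    and comm: "\<And>g. g \<in> carrier G \<Longrightarrow> \<rho> g * M = M * \<rho> g"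
  shows "\<exists>\<mu>. M = \<mu> \<cdot>\<^sub>m 1\<^sub>m n"
proof -
  have n: "n > 0" and rho: "\<And>g. g \<in> carrier G \<Longrightarrow> \<rho> g \<in> carrier_mat n n"
    using irr by (auto simp: irreducible_rep_def complex_rep_def)
  obtain \<mu> v where v: "v \<in> carrier_vec n" "v \<noteq> 0\<^sub>v n" "M *\<^sub>v v = \<mu> \<cdot>\<^sub>v v"
    using spectrum_non_empty[OF M n] M by (auto simp: spectrum_def eigenvalue_def eigenvector_def)
  define W where "W = {w \<in> carrier_vec n. M *\<^sub>v w = \<mu> \<cdot>\<^sub>v w}"
  have "is_subspace n W"
    unfolding is_subspace_def W_def using M
    by (auto simp: mult_add_distrib_mat_vec smult_add_distrib_vec mult_mat_vec smult_smult_assoc mult.commute)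
  moreover have "\<rho> g *\<^sub>v w \<in> W" if g: "g \<in> carrier G" and w: "w \<in> W" for g w
  proof -
    have wc: "w \<in> carrier_vec n" and mw: "M *\<^sub>v w = \<mu> \<cdot>\<^sub>v w" using w by (auto simp: W_def)
    have "M *\<^sub>v (\<rho> g *\<^sub>v w) = (\<rho> g * M) *\<^sub>v w"
      unfolding comm[OF g] using M rho[OF g] wc by simp
    also have "\<dots> = \<rho> g *\<^sub>v (\<mu> \<cdot>\<^sub>v w)" using M rho[OF g] wc mw by simp
    also have "\<dots> = \<mu> \<cdot>\<^sub>v (\<rho> g *\<^sub>v w)" by (rule mult_mat_vec[OF rho[OF g] wc])
    finally show ?thesis using rho[OF g] wc by (auto simp: W_def)
  qed
  ultimately have "W = {0\<^sub>v n} \<or> W = carrier_vec n" using irr unfolding irreducible_rep_def by blast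
  moreover have "v \<in> W" using v by (simp add: W_def)
  ultimately have W: "W = carrier_vec n" using v(2) by auto
  have "M = \<mu> \<cdot>\<^sub>m 1\<^sub>m n"
  proof (rule mat_eq_on_vecI[OF M])
    fix w :: "complex vec" assume w: "w \<in> carrier_vec n"
    then have "M *\<^sub>v w = \<mu> \<cdot>\<^sub>v w" using W unfolding W_def by blast
    also have "\<dots> = (\<mu> \<cdot>\<^sub>m 1\<^sub>m n) *\<^sub>v w" using w by (simp add: scalar_mat_mult_vec)
    finally show "M *\<^sub>v w = (\<mu> \<cdot>\<^sub>m 1\<^sub>m n) *\<^sub>v w" .
  qed simp
  then show ?thesis by blast
qed

context finite_group_rep
begin

text \<open>Conjugate the matrix unit \<open>E\<close> at \<open>(j, k)\<close> by all group
  elements and sum. By Schur the result is a scalar \<mu>, and the wanted sum is its entry at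
  \<open>(j, k)\<close>. For \<open>j = k\<close> the trace determines \<mu>, since conjugation
  preserves the trace 1 of \<open>E\<close>.\<close>

lemma sum_diagonal_entries:
  assumes irr: "irreducible_rep G n \<rho>" and jk: "j < n" "k < n"
  shows "(\<Sum>g\<in>carrier G. \<rho> g $$ (j,j) * \<rho> (inv g) $$ (k,k)) = (if j = k then of_nat (order G) / of_nat n else 0)"
proof -
  define E :: "complex mat" where "E = mat n n (\<lambda>(a,b). if a = j \<and> b = k then 1 else 0)"
  have E: "E \<in> carrier_mat n n" by (simp add: E_def)
  define \<Phi> where "\<Phi> = mat_sum n (carrier G) (\<lambda>g. \<rho> g * E * \<rho> (inv g))"
  have c: "\<rho> g * E * \<rho> (inv g) \<in> carrier_mat n n" if "g \<in> carrier G" for g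
    using that E by (intro mult_carrier_mat[of _ n n]) auto
  have entry: "(\<rho> g * E * \<rho> (inv g)) $$ (i,l) = \<rho> g $$ (i,j) * \<rho> (inv g) $$ (k,l)"
    if g: "g \<in> carrier G" and il: "i < n" "l < n" for g i l
  proof -
    have gE: "(\<rho> g * E) $$ (i,b) = (if b = k then \<rho> g $$ (i,j) else 0)" if "b < n" for b
    proof -
      have "(\<rho> g * E) $$ (i,b) = (\<Sum>a<n. \<rho> g $$ (i,a) * E $$ (a,b))"
        using that il g E by (intro mult_mat_entry) auto
      also have "\<dots> = (\<Sum>a<n. if a = j then (if b = k then \<rho> g $$ (i,j) else 0) else 0)"
        using that by (intro sum.cong) (auto simp: E_def)
      finally show ?thesis using jk by simp
    qed
    have "(\<rho> g * E * \<rho> (inv g)) $$ (i,l) = (\<Sum>b<n. (\<rho> g * E) $$ (i,b) * \<rho> (inv g) $$ (b,l))"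
      using il g E by (intro mult_mat_entry mult_carrier_mat[of _ n n]) auto
    also have "\<dots> = (\<Sum>b<n. if b = k then \<rho> g $$ (i,j) * \<rho> (inv g) $$ (k,l) else 0)"
      by (intro sum.cong) (auto simp: gE simp del: index_mult_mat(1))
    finally show ?thesis using jk by simp
  qed
  have "\<exists>\<mu>. \<Phi> = \<mu> \<cdot>\<^sub>m 1\<^sub>m n"
  proof (rule schur_scalar[OF irr])
    fix h assume h: "h \<in> carrier G"
    have "\<rho> h * \<Phi> = mat_sum n (carrier G) (\<lambda>g. \<rho> h * (\<rho> g * E * \<rho> (inv g)))"
      unfolding \<Phi>_def using h c by (intro mult_mat_sum) auto
    also have "\<dots> = mat_sum n (carrier G) (\<lambda>g. \<rho> (h \<otimes> g) * E * \<rho> (inv g))"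
      using h E by (intro mat_sum_cong) (simp add: rho_mult assoc_mult_mat[of _ n n _ n _ n] mult_carrier_mat[of _ n n])
    also have "\<dots> = mat_sum n (carrier G) (\<lambda>g. \<rho> g * E * \<rho> (inv g \<otimes> h))"
      unfolding mat_sum_def using h
      by (intro arg_cong[where f="mat n n"] ext sum.reindex_bij_witness[where i="\<lambda>g. inv h \<otimes> g" and j="\<lambda>g. h \<otimes> g"])
         (auto simp: inv_mult_group m_assoc mult_inv_cancel)
    also have "\<dots> = mat_sum n (carrier G) (\<lambda>g. \<rho> g * E * \<rho> (inv g) * \<rho> h)"
      using h E by (intro mat_sum_cong) (simp add: rho_mult assoc_mult_mat[of _ n n _ n _ n] mult_carrier_mat[of _ n n])
    also have "\<dots> = \<Phi> * \<rho> h"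
      unfolding \<Phi>_def using h c by (intro mat_sum_mult[symmetric]) auto
    finally show "\<rho> h * \<Phi> = \<Phi> * \<rho> h" .
  qed (simp add: \<Phi>_def)
  then obtain \<mu> where \<mu>: "\<Phi> = \<mu> \<cdot>\<^sub>m 1\<^sub>m n" ..
  have sum: "(\<Sum>g\<in>carrier G. \<rho> g $$ (j,j) * \<rho> (inv g) $$ (k,k)) = \<Phi> $$ (j,k)"
    using jk by (simp add: \<Phi>_def mat_sum_entry entry del: index_mult_mat(1))
  show ?thesis
  proof (cases "j = k")
    case False
    then show ?thesis using sum jk by (simp add: \<mu>)
  next
    case True
    have "of_nat n * \<mu> = trace_mat \<Phi>" by (simp add: \<mu> trace_mat_def)
    also have "\<dots> = (\<Sum>g\<in>carrier G. trace_mat (\<rho> g * E * \<rho> (inv g)))"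
    proof -
      have "trace_mat (\<rho> g * E * \<rho> (inv g)) = (\<Sum>i<n. (\<rho> g * E * \<rho> (inv g)) $$ (i,i))" if "g \<in> carrier G" for g
        using that by (simp add: trace_mat_def del: index_mult_mat(1))
      then show ?thesis
        by (simp add: trace_mat_def \<Phi>_def mat_sum_entry sum.swap[of _ "carrier G"] del: index_mult_mat(1))
    qed
    also have "\<dots> = (\<Sum>g\<in>carrier G. 1)"
    proof (rule sum.cong[OF refl])
      fix g assume g: "g \<in> carrier G"
      have "trace_mat (\<rho> g * E * \<rho> (inv g)) = trace_mat (\<rho> (inv g) * (\<rho> g * E))"
        using g E by (intro trace_mat_comm[of _ n] mult_carrier_mat[of _ n n]) auto
      also have "\<rho> (inv g) * (\<rho> g * E) = \<rho> (inv g \<otimes> g) * E"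
        using rho_mult[of "inv g" g] g E by (simp add: assoc_mult_mat[of _ n n _ n _ n])
      also have "\<dots> = E" using g E by (simp add: rho_one)
      finally show "trace_mat (\<rho> g * E * \<rho> (inv g)) = 1"
        using jk True by (simp add: trace_mat_def E_def)
    qed
    finally have "of_nat n * \<mu> = of_nat (order G)" by (simp add: order_def)
    then have "\<mu> = of_nat (order G) / of_nat n" using jk by (simp add: field_simps)
    then show ?thesis using sum jk True by (simp add: \<mu>)
  qed
qed

text \<open>Expanding both traces, only the \<open>n\<close> diagonal pairs survive, each
  contributing \<open>order G / n\<close>.\<close>

lemma sum_norm_trace:
  assumes irr: "irreducible_rep G n \<rho>"
  shows "(\<Sum>g\<in>carrier G. (cmod (trace_mat (\<rho> g)))\<^sup>2) = order G"
proof -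
  have n: "n > 0" using irr by (simp add: irreducible_rep_def)
  have "complex_of_real (\<Sum>g\<in>carrier G. (cmod (trace_mat (\<rho> g)))\<^sup>2)
      = (\<Sum>g\<in>carrier G. trace_mat (\<rho> g) * trace_mat (\<rho> (inv g)))"
    by (simp add: trace_rho_inv complex_norm_square del: of_real_power)
  also have "\<dots> = (\<Sum>g\<in>carrier G. \<Sum>j<n. \<Sum>k<n. \<rho> g $$ (j,j) * \<rho> (inv g) $$ (k,k))"
    by (intro sum.cong refl) (simp add: trace_mat_def sum_product)
  also have "\<dots> = (\<Sum>j<n. \<Sum>g\<in>carrier G. \<Sum>k<n. \<rho> g $$ (j,j) * \<rho> (inv g) $$ (k,k))"
    by (rule sum.swap)
  also have "\<dots> = (\<Sum>j<n. \<Sum>k<n. \<Sum>g\<in>carrier G. \<rho> g $$ (j,j) * \<rho> (inv g) $$ (k,k))"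
    by (intro sum.cong refl sum.swap)
  also have "\<dots> = (\<Sum>j<n. \<Sum>k<n. if j = k then of_nat (order G) / of_nat n else 0)"
    by (intro sum.cong refl sum_diagonal_entries[OF irr]) auto
  also have "\<dots> = of_nat (order G)" using n by simp
  finally have "complex_of_real (\<Sum>g\<in>carrier G. (cmod (trace_mat (\<rho> g)))\<^sup>2) = complex_of_real (real (order G))"
    by simp
  then show ?thesis unfolding of_real_eq_iff .
qed

text \<open>Cauchy-Schwarz against the real part of the character, whose square sum over
  \<open>N\<close> is at most that of the whole character over \<open>G\<close>.\<close>

lemma trace_sum_bound:
  assumes irr: "irreducible_rep G n \<rho>" and N: "N \<subseteq> carrier G"
    and T: "(\<Sum>x\<in>N. complex_of_real (f x) * trace_mat (\<rho> x)) = complex_of_real T"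
  shows "T\<^sup>2 \<le> real (order G) * (\<Sum>x\<in>N. (f x)\<^sup>2)"
proof -
  define r where "r x = Re (trace_mat (\<rho> x))" for x
  \<comment> \<open>This choice minimises the quadratic bound in \<open>t\<close> reached at the
    end.\<close>
  define t where "t = T / real (order G)"
  have o: "real (order G) > 0" using order_gt_0_iff_finite fin by simp
  have Tr: "(\<Sum>x\<in>N. f x * r x) = T" using arg_cong[OF T, of Re] by (simp add: r_def)
  have "(\<Sum>x\<in>N. (r x)\<^sup>2) \<le> (\<Sum>x\<in>N. (cmod (trace_mat (\<rho> x)))\<^sup>2)"
    by (intro sum_mono) (simp add: r_def cmod_power2)
  also have "\<dots> \<le> (\<Sum>x\<in>carrier G. (cmod (trace_mat (\<rho> x)))\<^sup>2)"
    using fin N by (intro sum_mono2) auto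
  finally have rr: "(\<Sum>x\<in>N. (r x)\<^sup>2) \<le> real (order G)" using sum_norm_trace[OF irr] by simp
  have "0 \<le> (\<Sum>x\<in>N. (f x - t * r x)\<^sup>2)" by (intro sum_nonneg) auto
  also have "\<dots> = (\<Sum>x\<in>N. (f x)\<^sup>2 - 2 * t * (f x * r x) + t\<^sup>2 * (r x)\<^sup>2)"
    by (intro sum.cong) (auto simp: power2_eq_square algebra_simps)
  also have "\<dots> = (\<Sum>x\<in>N. (f x)\<^sup>2) - 2 * t * T + t\<^sup>2 * (\<Sum>x\<in>N. (r x)\<^sup>2)"
    by (simp add: sum.distrib sum_subtractf sum_distrib_left[symmetric] Tr)
  also have "\<dots> \<le> (\<Sum>x\<in>N. (f x)\<^sup>2) - 2 * t * T + t\<^sup>2 * real (order G)"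
    using rr by (intro add_left_mono mult_left_mono) auto
  finally show ?thesis using o by (simp add: t_def field_simps power2_eq_square)
qed

end

section \<open>From a sign element of a normal subgroup to a bound on degrees\<close>

lemma degree_bound:
  assumes G: "group G" and fin: "finite (carrier G)" and irr: "irreducible_rep G n \<rho>"
    and N: "N \<lhd> G" and sign: "sign_element (G\<lparr>carrier := N\<rparr>) v"
  shows "2 * real n ^ 2 \<le> real (order G) * (1 + \<bar>v\<bar>)"
proof -
  let ?K = "G\<lparr>carrier := N\<rparr>"
  interpret normal N G by fact
  have NG: "N \<subseteq> carrier G" by (rule subset)
  have rep: "complex_rep G n \<rho>" using irr by (simp add: irreducible_rep_def)
  have n: "n > 0" using irr by (simp add: irreducible_rep_def)
  interpret R: finite_group_rep G n \<rho> using fin rep by unfold_locales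
  interpret K: group ?K by (rule subgroup_imp_group) (rule subgroup_axioms)
  have repK: "complex_rep ?K n \<rho>" using rep NG by (auto simp: complex_rep_def subset_iff)
  interpret K: finite_group_rep ?K n \<rho> using fin NG repK by unfold_locales (auto intro: finite_subset)
  obtain r c s where s: "\<And>x. x \<in> N \<Longrightarrow> c (inv\<^bsub>?K\<^esub> x) = c x \<and> s (inv\<^bsub>?K\<^esub> x) = s x
        \<and> conv ?K s s x = dirac ?K x \<and> conv ?K (sqrt_one ?K r) (conv ?K c c) x = s x" and v: "s \<one>\<^bsub>G\<^esub> = v"
    using sign by (auto simp: sign_element_def)
  define A where "A = rep_sum ?K n \<rho> (sqrt_one ?K r)"
  define B where "B = rep_sum ?K n \<rho> c * rep_sum ?K n \<rho> c"
  define S where "S = rep_sum ?K n \<rho> s"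
  have A: "A \<in> carrier_mat n n" and S: "S \<in> carrier_mat n n" by (simp_all add: A_def S_def)
  have B: "B \<in> carrier_mat n n" unfolding B_def by (rule mult_carrier_mat) (rule rep_sum_carrier)+
  have SS: "S * S = 1\<^sub>m n"
  proof -
    have "S * S = rep_sum ?K n \<rho> (conv ?K s s)" by (simp add: S_def K.rep_sum_conv)
    also have "\<dots> = rep_sum ?K n \<rho> (dirac ?K)" by (rule rep_sum_cong) (use s in auto)
    finally show ?thesis by (simp add: K.rep_sum_dirac)
  qed
  have AB: "A * B = S"
  proof -
    have "A * B = rep_sum ?K n \<rho> (conv ?K (sqrt_one ?K r) (conv ?K c c))"
      by (simp add: A_def B_def K.rep_sum_conv)
    also have "\<dots> = S" unfolding S_def by (rule rep_sum_cong) (use s in auto)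
    finally show ?thesis .
  qed
  \<comment> \<open>Conjugation by \<open>g\<close> permutes the elements of square one in the
    normal subgroup \<open>N\<close>, so \<open>A\<close> commutes with every
    \<open>\<rho> g\<close>.\<close>
  have "\<exists>\<mu>. A = \<mu> \<cdot>\<^sub>m 1\<^sub>m n"
  proof (rule schur_scalar[OF irr A])
    fix g assume g: "g \<in> carrier G"
    have cx: "complex_of_real (sqrt_one ?K r x) \<cdot>\<^sub>m \<rho> x \<in> carrier_mat n n" if "x \<in> N" for x
      using that NG by auto
    have conj: "g \<otimes>\<^bsub>G\<^esub> x \<otimes>\<^bsub>G\<^esub> inv\<^bsub>G\<^esub> g \<in> N" "inv\<^bsub>G\<^esub> g \<otimes>\<^bsub>G\<^esub> x \<otimes>\<^bsub>G\<^esub> g \<in> N" if "x \<in> N" for x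
      using g that inv_op_closed1 inv_op_closed2 by auto
    have sq: "sqrt_one ?K r (inv\<^bsub>G\<^esub> g \<otimes>\<^bsub>G\<^esub> x \<otimes>\<^bsub>G\<^esub> g) = sqrt_one ?K r x" if "x \<in> N" for x
    proof -
      have x: "x \<in> carrier G" using that NG by auto
      have "inv\<^bsub>G\<^esub> g \<otimes>\<^bsub>G\<^esub> x \<otimes>\<^bsub>G\<^esub> g \<otimes>\<^bsub>G\<^esub> (inv\<^bsub>G\<^esub> g \<otimes>\<^bsub>G\<^esub> x \<otimes>\<^bsub>G\<^esub> g) = inv\<^bsub>G\<^esub> g \<otimes>\<^bsub>G\<^esub> (x \<otimes>\<^bsub>G\<^esub> x) \<otimes>\<^bsub>G\<^esub> g"
        using g x by (simp add: m_assoc mult_inv_cancel)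
      moreover have "inv\<^bsub>G\<^esub> g \<otimes>\<^bsub>G\<^esub> (x \<otimes>\<^bsub>G\<^esub> x) \<otimes>\<^bsub>G\<^esub> g = \<one>\<^bsub>G\<^esub> \<longleftrightarrow> x \<otimes>\<^bsub>G\<^esub> x = \<one>\<^bsub>G\<^esub>"
      proof
        assume e: "inv\<^bsub>G\<^esub> g \<otimes>\<^bsub>G\<^esub> (x \<otimes>\<^bsub>G\<^esub> x) \<otimes>\<^bsub>G\<^esub> g = \<one>\<^bsub>G\<^esub>"
        have "x \<otimes>\<^bsub>G\<^esub> x = g \<otimes>\<^bsub>G\<^esub> (inv\<^bsub>G\<^esub> g \<otimes>\<^bsub>G\<^esub> (x \<otimes>\<^bsub>G\<^esub> x) \<otimes>\<^bsub>G\<^esub> g) \<otimes>\<^bsub>G\<^esub> inv\<^bsub>G\<^esub> g"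
          using g x by (simp add: m_assoc mult_inv_cancel)
        then show "x \<otimes>\<^bsub>G\<^esub> x = \<one>\<^bsub>G\<^esub>" using g by (simp add: e)
      qed (use g in simp)
      ultimately show ?thesis by (simp add: sqrt_one_def)
    qed
    have "\<rho> g * A = mat_sum n N (\<lambda>x. \<rho> g * (complex_of_real (sqrt_one ?K r x) \<cdot>\<^sub>m \<rho> x))"
      unfolding A_def rep_sum_def using g cx by (simp add: mult_mat_sum)
    also have "\<dots> = mat_sum n N (\<lambda>x. complex_of_real (sqrt_one ?K r x) \<cdot>\<^sub>m \<rho> (g \<otimes>\<^bsub>G\<^esub> x))"
      using g NG by (intro mat_sum_cong) (auto simp: R.rho_mult subset_iff intro!: mult_smult_distrib[of _ n n _ n])
    also have "\<dots> = mat_sum n N (\<lambda>x. complex_of_real (sqrt_one ?K r x) \<cdot>\<^sub>m \<rho> (x \<otimes>\<^bsub>G\<^esub> g))"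
      unfolding mat_sum_def
    proof (intro arg_cong[where f="mat n n"] ext sum.reindex_bij_witness[where
          i="\<lambda>x. inv\<^bsub>G\<^esub> g \<otimes>\<^bsub>G\<^esub> x \<otimes>\<^bsub>G\<^esub> g" and j="\<lambda>x. g \<otimes>\<^bsub>G\<^esub> x \<otimes>\<^bsub>G\<^esub> inv\<^bsub>G\<^esub> g"])
      fix x ij assume x: "x \<in> N"
      then have xG: "x \<in> carrier G" using NG by auto
      show 1: "inv\<^bsub>G\<^esub> g \<otimes>\<^bsub>G\<^esub> (g \<otimes>\<^bsub>G\<^esub> x \<otimes>\<^bsub>G\<^esub> inv\<^bsub>G\<^esub> g) \<otimes>\<^bsub>G\<^esub> g = x"
        using g xG by (simp add: m_assoc mult_inv_cancel)
      have 2: "g \<otimes>\<^bsub>G\<^esub> x \<otimes>\<^bsub>G\<^esub> inv\<^bsub>G\<^esub> g \<otimes>\<^bsub>G\<^esub> g = g \<otimes>\<^bsub>G\<^esub> x" using g xG by (simp add: m_assoc)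
      show "(complex_of_real (sqrt_one ?K r (g \<otimes>\<^bsub>G\<^esub> x \<otimes>\<^bsub>G\<^esub> inv\<^bsub>G\<^esub> g)) \<cdot>\<^sub>m \<rho> (g \<otimes>\<^bsub>G\<^esub> x \<otimes>\<^bsub>G\<^esub> inv\<^bsub>G\<^esub> g \<otimes>\<^bsub>G\<^esub> g)) $$ ij
        = (complex_of_real (sqrt_one ?K r x) \<cdot>\<^sub>m \<rho> (g \<otimes>\<^bsub>G\<^esub> x)) $$ ij"
        using sq[OF conj(1)[OF x]] unfolding 1 2 by simp
    next
      fix x ij assume x: "x \<in> N"
      then have xG: "x \<in> carrier G" using NG by auto
      show "g \<otimes>\<^bsub>G\<^esub> (inv\<^bsub>G\<^esub> g \<otimes>\<^bsub>G\<^esub> x \<otimes>\<^bsub>G\<^esub> g) \<otimes>\<^bsub>G\<^esub> inv\<^bsub>G\<^esub> g = x"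
        using g xG by (simp add: m_assoc mult_inv_cancel)
    qed (use conj in auto)
    also have "\<dots> = mat_sum n N (\<lambda>x. (complex_of_real (sqrt_one ?K r x) \<cdot>\<^sub>m \<rho> x) * \<rho> g)"
      using g NG by (intro mat_sum_cong) (auto simp: R.rho_mult subset_iff intro!: mult_smult_assoc_mat[of _ n n _ n, symmetric])
    also have "\<dots> = A * \<rho> g"
      unfolding A_def rep_sum_def using g cx by (simp add: mat_sum_mult)
    finally show "\<rho> g * A = A * \<rho> g" .
  qed
  then obtain \<mu> where \<mu>: "A = \<mu> \<cdot>\<^sub>m 1\<^sub>m n" ..
  have SB: "S *\<^sub>v w = \<mu> \<cdot>\<^sub>v (B *\<^sub>v w)" if w: "w \<in> carrier_vec n" for w
  proof -
    have Bw: "B *\<^sub>v w \<in> carrier_vec n" using B w by (metis mult_mat_vec_carrier)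
    have "S *\<^sub>v w = A *\<^sub>v (B *\<^sub>v w)" unfolding AB[symmetric] using A B w by simp
    also have "\<dots> = \<mu> \<cdot>\<^sub>v (B *\<^sub>v w)" unfolding \<mu> using Bw by (rule scalar_mat_mult_vec)
    finally show ?thesis .
  qed
  have SSv: "S *\<^sub>v (S *\<^sub>v w) = w" if w: "w \<in> carrier_vec n" for w
  proof -
    have "S *\<^sub>v (S *\<^sub>v w) = (S * S) *\<^sub>v w" using S w by simp
    then show ?thesis using w by (simp add: SS)
  qed
  have Sv: "S *\<^sub>v w \<in> carrier_vec n" if "w \<in> carrier_vec n" for w
    using S that by (metis mult_mat_vec_carrier)
  \<comment> \<open>\<open>S\<close> is \<mu> times \<open>B\<close>, so an eigenvector of
    \<open>S\<close> with nonzero eigenvalue \<sigma> is one of \<open>B\<close> for \<sigma> /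
    \<mu>, and \<open>B\<close> is the square of a self-adjoint matrix.\<close>
  have eig: "\<mu> \<noteq> 0 \<and> (\<exists>t\<ge>0. \<sigma> / \<mu> = complex_of_real t)"
    if w: "w \<in> carrier_vec n" "w \<noteq> 0\<^sub>v n" "S *\<^sub>v w = \<sigma> \<cdot>\<^sub>v w" and \<sigma>: "\<sigma> \<noteq> 0" for w \<sigma>
  proof -
    obtain i where i: "i < n" "w $ i \<noteq> 0" using w by (metis carrier_vecD eq_vecI index_zero_vec(1) index_zero_vec(2))
    have e: "\<mu> \<cdot>\<^sub>v (B *\<^sub>v w) = \<sigma> \<cdot>\<^sub>v w" using SB[OF w(1)] w(3) by simp
    have dB: "dim_vec (B *\<^sub>v w) = n" using B by simp
    have ent: "\<mu> * (B *\<^sub>v w) $ k = \<sigma> * w $ k" if "k < n" for k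
      using arg_cong[OF e, of "\<lambda>u. u $ k"] that dB w(1) by (simp del: index_mult_mat_vec)
    have m: "\<mu> \<noteq> 0" using ent[OF i(1)] i \<sigma> by auto
    have "B *\<^sub>v w = (\<sigma> / \<mu>) \<cdot>\<^sub>v w"
    proof (rule eq_vecI)
      fix k assume "k < dim_vec ((\<sigma> / \<mu>) \<cdot>\<^sub>v w)"
      then have "k < n" using w by simp
      then show "(B *\<^sub>v w) $ k = ((\<sigma> / \<mu>) \<cdot>\<^sub>v w) $ k"
        using ent[of k] m w(1) by (simp add: field_simps del: index_mult_mat_vec)
    qed (use w dB in simp)
    then have "\<exists>t\<ge>0. \<sigma> / \<mu> = complex_of_real t"
      unfolding B_def using s w by (intro K.eigenvalue_rep_sum_square_nonneg[of c w]) auto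
    then show ?thesis using m by blast
  qed
  \<comment> \<open>Otherwise the involution \<open>S\<close> has both eigenvalues 1 and -1, and
    then 1 / \<mu> and -1 / \<mu> are both nonnegative.\<close>
  have "S = 1\<^sub>m n \<or> S = - 1\<^sub>m n"
  proof (rule ccontr)
    assume ns: "\<not> ?thesis"
    obtain w1 where w1: "w1 \<in> carrier_vec n" "S *\<^sub>v w1 \<noteq> w1"
      using ns mat_eq_on_vecI[OF S one_carrier_mat] by force
    have "\<exists>w\<in>carrier_vec n. S *\<^sub>v w \<noteq> (- 1\<^sub>m n) *\<^sub>v w"
      using ns mat_eq_on_vecI[OF S, of "- 1\<^sub>m n"] by auto
    then obtain w2 where w2: "w2 \<in> carrier_vec n" "S *\<^sub>v w2 \<noteq> - w2"
      by (auto simp: uminus_mult_mat_vec)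
    \<comment> \<open>For an involution, S w - w and S w + w are eigenvectors for -1 and 1 as soon
      as they are nonzero.\<close>
    define u1 where "u1 = S *\<^sub>v w1 - w1"
    define u2 where "u2 = S *\<^sub>v w2 + w2"
    have c: "u1 \<in> carrier_vec n" "u2 \<in> carrier_vec n" using w1 w2 Sv by (auto simp: u1_def u2_def)
    have nz1: "u1 \<noteq> 0\<^sub>v n"
    proof
      assume z: "u1 = 0\<^sub>v n"
      have "S *\<^sub>v w1 = u1 + w1" using w1 S by (intro eq_vecI) (auto simp: u1_def simp del: index_mult_mat_vec)
      then show False using w1 z by simp
    qed
    have nz2: "u2 \<noteq> 0\<^sub>v n"
    proof
      assume z: "u2 = 0\<^sub>v n"
      have "S *\<^sub>v w2 = u2 - w2" using w2 S by (intro eq_vecI) (auto simp: u2_def simp del: index_mult_mat_vec)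
      then show False using w2 z by auto
    qed
    have ev1: "S *\<^sub>v u1 = (-1) \<cdot>\<^sub>v u1"
    proof -
      have "S *\<^sub>v u1 = w1 - S *\<^sub>v w1"
        using SSv[OF w1(1)] mult_minus_distrib_mat_vec[OF S Sv[OF w1(1)] w1(1)] by (simp add: u1_def)
      also have "\<dots> = (-1) \<cdot>\<^sub>v u1" using w1 Sv[OF w1(1)] S by (intro eq_vecI) (auto simp: u1_def simp del: index_mult_mat_vec)
      finally show ?thesis .
    qed
    have ev2: "S *\<^sub>v u2 = 1 \<cdot>\<^sub>v u2"
    proof -
      have "S *\<^sub>v u2 = w2 + S *\<^sub>v w2"
        using SSv[OF w2(1)] mult_add_distrib_mat_vec[OF S Sv[OF w2(1)] w2(1)] by (simp add: u2_def)
      also have "\<dots> = 1 \<cdot>\<^sub>v u2" using w2 Sv[OF w2(1)] S by (intro eq_vecI) (auto simp: u2_def simp del: index_mult_mat_vec)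
      finally show ?thesis .
    qed
    obtain t1 where t1: "\<mu> \<noteq> 0" "t1 \<ge> 0" "-1 / \<mu> = complex_of_real t1"
      using eig[OF c(1) nz1 ev1] by auto
    obtain t2 where t2: "t2 \<ge> 0" "1 / \<mu> = complex_of_real t2"
      using eig[OF c(2) nz2 ev2] by auto
    have "complex_of_real (t1 + t2) = 0" by (simp flip: t1(3) t2(2))
    then have "t1 + t2 = 0" by (simp only: of_real_eq_0_iff)
    then have "t2 = 0" using t1 t2 by simp
    then show False using t1 t2 by simp
  qed
  then obtain \<sigma> :: real where \<sigma>: "\<sigma> = 1 \<or> \<sigma> = -1" and S\<sigma>: "\<And>i. i < n \<Longrightarrow> S $$ (i,i) = complex_of_real \<sigma>"
  proof
    assume "S = 1\<^sub>m n" then show ?thesis by (intro that[of 1]) auto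
  next
    assume "S = - 1\<^sub>m n" then show ?thesis by (intro that[of "-1"]) auto
  qed
  \<comment> \<open>The factor \<sigma> cancels the sign of \<open>S\<close>: both summands of
    \<open>f\<close> act as the identity, so the total trace is \<open>2 * n\<close>.\<close>
  define f where "f x = dirac ?K x + \<sigma> * s x" for x
  have finN: "finite N" using fin NG finite_subset by blast
  have "(\<Sum>x\<in>N. complex_of_real (f x) * trace_mat (\<rho> x)) = complex_of_real (2 * real n)"
  proof -
    have tr: "(\<Sum>x\<in>N. complex_of_real (h x) * trace_mat (\<rho> x)) = (\<Sum>i<n. rep_sum ?K n \<rho> h $$ (i,i))" for h
    proof -
      have "(\<Sum>x\<in>N. complex_of_real (h x) * trace_mat (\<rho> x)) = (\<Sum>x\<in>N. \<Sum>i<n. complex_of_real (h x) * \<rho> x $$ (i,i))"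
        using NG by (intro sum.cong) (auto simp: trace_mat_def sum_distrib_left subset_iff)
      then show ?thesis by (subst (asm) sum.swap) (simp add: K.rep_sum_entry)
    qed
    have "(\<Sum>x\<in>N. complex_of_real (f x) * trace_mat (\<rho> x))
      = (\<Sum>x\<in>N. complex_of_real (dirac ?K x) * trace_mat (\<rho> x)) + \<sigma> * (\<Sum>x\<in>N. complex_of_real (s x) * trace_mat (\<rho> x))"
      by (simp add: f_def distrib_right sum.distrib sum_distrib_left mult.assoc)
    also have "\<dots> = of_nat n + \<sigma> * (of_nat n * \<sigma>)"
      unfolding tr K.rep_sum_dirac S_def[symmetric] by (simp add: S\<sigma>)
    also have "\<dots> = complex_of_real (2 * real n)" using \<sigma> by auto
    finally show ?thesis .
  qed
  from R.trace_sum_bound[OF irr NG this]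
  have "4 * real n ^ 2 \<le> real (order G) * (\<Sum>x\<in>N. (f x)\<^sup>2)" by (simp add: power_mult_distrib)
  also have "(\<Sum>x\<in>N. (f x)\<^sup>2) = 2 + 2 * \<sigma> * v"
  proof -
    \<comment> \<open>As \<open>s\<close> is inversion-symmetric, its square sum is the coefficient
      of \<open>conv ?K s s\<close> at the identity.\<close>
    have ss: "(\<Sum>x\<in>N. (s x)\<^sup>2) = 1"
    proof -
      have "(\<Sum>x\<in>N. (s x)\<^sup>2) = conv ?K s s \<one>\<^bsub>G\<^esub>"
        unfolding conv_def using s K.r_one[OF K.inv_closed] by (auto simp: power2_eq_square intro!: sum.cong)
      then show ?thesis using s[of "\<one>\<^bsub>G\<^esub>"] by (simp add: dirac_def)
    qed
    have "(\<Sum>x\<in>N. (f x)\<^sup>2) = (\<Sum>x\<in>N. dirac ?K x + 2 * \<sigma> * (if x = \<one>\<^bsub>G\<^esub> then v else 0) + (s x)\<^sup>2)"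
      using \<sigma> v by (intro sum.cong) (auto simp: f_def dirac_def power2_eq_square algebra_simps)
    also have "\<dots> = 2 + 2 * \<sigma> * v"
      using finN by (simp add: sum.distrib ss dirac_def sum_distrib_left[symmetric])
    finally show ?thesis .
  qed
  also have "real (order G) * (2 + 2 * \<sigma> * v) \<le> real (order G) * (2 + 2 * \<bar>v\<bar>)"
    using \<sigma> by (intro mult_left_mono) auto
  finally show ?thesis by (simp add: algebra_simps)
qed

section \<open>The degree bound for extensions of powers of PSL2\<close>

text \<open>Adding 1 permutes the field. Comparing the sums over all elements shows that the
  cardinality, a power of 2, vanishes in the field.\<close>

lemma char2_if_card_power2:
  assumes "card (UNIV :: 'f::{field,finite} set) = 2 ^ m"
  shows "(1::'f) + 1 = 0"
proof -
  have "(\<Sum>x\<in>UNIV. x + 1) = (\<Sum>x\<in>UNIV. x :: 'f)"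
    by (rule sum.reindex_bij_witness[where i="\<lambda>x. x - 1" and j="\<lambda>x. x + 1"]) auto
  then have "of_nat (card (UNIV :: 'f set)) = (0::'f)" by (simp add: sum.distrib)
  then have "(2::'f) ^ m = 0" by (simp add: assms)
  then show ?thesis by simp
qed

context finite_char2
begin

text \<open>As 1 is its only square root, PSL2 is SL2 up to singleton cosets, and everything carries
  over along \<open>the_elem\<close>.\<close>

lemma SL2_centre_trivial: "(SL2_centre :: ('f \<times> 'f \<times> 'f \<times> 'f) set) = {\<one>\<^bsub>S\<^esub>}"
proof -
  have "l * l = 1 \<longleftrightarrow> l = 1" for l :: 'f using square_eq[of l 1] by simp
  then show ?thesis by (auto simp: SL2_centre_def SL2_def)
qed

lemma group_PSL2: "group (PSL2 :: ('f \<times> 'f \<times> 'f \<times> 'f) set monoid)"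
  unfolding PSL2_def SL2_centre_trivial
  by (intro normal.factorgroup_is_group group.one_is_normal group_SL2)

lemma PSL2_iso: "the_elem \<in> iso (PSL2 :: ('f \<times> 'f \<times> 'f \<times> 'f) set monoid) S"
  unfolding PSL2_def SL2_centre_trivial by (rule group.trivial_factor_iso[OF group_SL2])

lemma card_PSL2: "card (carrier (PSL2 :: ('f \<times> 'f \<times> 'f \<times> 'f) set monoid)) = q * (q\<^sup>2 - 1)"
  using PSL2_iso bij_betw_same_card by (fastforce simp: iso_def order_S)

lemma sign_element_PSL2: "sign_element (PSL2 :: ('f \<times> 'f \<times> 'f \<times> 'f) set monoid) (2 / (real q + 1))"
  by (rule sign_element_iso[OF group_PSL2 group_SL2 PSL2_iso sign_element_SL2])

end

section \<open>The largest degree is attained, and the final estimate\<close>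

lemma irreducible_rep_trivial:
  assumes "group G"
  shows "irreducible_rep G 1 (\<lambda>_. 1\<^sub>m 1)"
proof -
  have "W = {0\<^sub>v 1} \<or> W = carrier_vec 1" if W: "is_subspace 1 W" for W
  proof (cases "W \<subseteq> {0\<^sub>v 1}")
    case True
    then show ?thesis using W by (auto simp: is_subspace_def)
  next
    case False
    then obtain w where w: "w \<in> W" "w \<noteq> 0\<^sub>v 1" by auto
    then have wc: "w \<in> carrier_vec 1" using W by (auto simp: is_subspace_def)
    have w0: "w $ 0 \<noteq> 0"
    proof
      assume "w $ 0 = 0"
      then have "w = 0\<^sub>v 1" using wc by (intro eq_vecI) auto
      then show False using w by simp
    qed
    have "u \<in> W" if u: "u \<in> carrier_vec 1" for u
    proof -
      have "u = (u $ 0 / w $ 0) \<cdot>\<^sub>v w" using u wc w0 by (intro eq_vecI) auto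
      then show ?thesis using W w(1) unfolding is_subspace_def by metis
    qed
    then show ?thesis using W by (auto simp: is_subspace_def)
  qed
  then show ?thesis by (simp add: irreducible_rep_def complex_rep_def)
qed

text \<open>\<open>Max\<close> is meaningful on finite nonempty sets: the bound gives finiteness,
  the trivial representation gives a member.\<close>

lemma irreducible_rep_b_max:
  assumes "group G" and bound: "\<And>n \<rho>. irreducible_rep G n \<rho> \<Longrightarrow> n \<le> B"
  obtains \<rho> where "irreducible_rep G (b_max G) \<rho>"
proof -
  let ?D = "{n. \<exists>\<rho>. irreducible_rep G n \<rho>}"
  have "finite ?D" by (rule finite_subset[of _ "{..B}"]) (use bound in auto)
  moreover have "?D \<noteq> {}" using irreducible_rep_trivial[OF assms(1)] by blast
  ultimately have "Max ?D \<in> ?D" by (rule Max_in)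
  then show ?thesis using that by (auto simp: b_max_def)
qed

text \<open>The bound yields \<open>7 * b \<le> 11 * e\<close>, which exceeds
  \<open>sqrt b + 1\<close> once \<open>b \<ge> 9\<close>. For smaller \<open>b\<close>, the lower
  bound \<open>504 = 9 * (9 + 47)\<close> forces \<open>e \<ge> 47\<close>.\<close>

lemma quadratic_gap:
  fixes b e :: real
  assumes b: "b > 0" and bound: "18 * b\<^sup>2 \<le> 11 * (b * (b + e))" and large: "b * (b + e) \<ge> 504"
  shows "e > sqrt b + 1 \<and> b * (b + e) < e ^ 4 - e ^ 3"
proof -
  have pos: "b + e > 0" using b large zero_less_mult_pos[of b "b + e"] by simp
  have "b * (18 * b) \<le> b * (11 * (b + e))" using bound by (simp add: power2_eq_square algebra_simps)
  then have e: "7 * b \<le> 11 * e" using b by simp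
  have e1: "e > sqrt b + 1"
  proof (cases "b \<ge> 9")
    case True
    then have "sqrt b \<ge> 3" by (simp add: real_le_rsqrt)
    then have "3 * sqrt b \<le> sqrt b * sqrt b" using b by (intro mult_right_mono) auto
    then have "3 * sqrt b \<le> b" using b by simp
    then show ?thesis using e \<open>sqrt b \<ge> 3\<close> by linarith
  next
    case False
    then have "sqrt b < 3" by (simp add: real_less_lsqrt)
    moreover have "e \<ge> 47"
    proof (rule ccontr)
      assume "\<not> ?thesis"
      then have "b * (b + e) < 9 * (9 + 47)" using False pos by (intro mult_strict_mono) auto
      then show False using large by simp
    qed
    ultimately show ?thesis by simp
  qed
  have "sqrt b < e - 1" using e1 by simp
  then have "(sqrt b)\<^sup>2 < (e - 1)\<^sup>2" using b by (intro power_strict_mono) auto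
  then have be: "b < (e - 1)\<^sup>2" using b by simp
  have epos: "e > 1" using e1 b by (smt (verit) real_sqrt_gt_zero)
  have "b * (b + e) < (e - 1)\<^sup>2 * ((e - 1)\<^sup>2 + e)"
    using be b epos by (intro mult_strict_mono) auto
  also have "\<dots> = (e - 1) * (e^3 - (e\<^sup>2 + (e - 1)\<^sup>2))"
    by (simp add: algebra_simps power2_eq_square power3_eq_cube)
  also have "\<dots> \<le> (e - 1) * e^3" using epos by (intro mult_left_mono) auto
  also have "\<dots> = e^4 - e^3" by (simp add: algebra_simps eval_nat_numeral)
  finally show ?thesis using e1 by blast
qed

theorem theorem5p3:
  fixes G :: "('g, 'b) monoid_scheme" and N :: "'g set"
    and q k :: nat and e :: real
    and F :: "'f::{field, finite} itself"
  assumes "group G" and "finite (carrier G)"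
    and "\<exists>m. q = 2 ^ m" and "q \<ge> 8"
    and "card (UNIV :: 'f set) = q"
    and "minimal_normal G N"
    and "G\<lparr>carrier := N\<rparr> \<cong> product_group {..<k} (\<lambda>_. (PSL2 :: (('f \<times> 'f \<times> 'f \<times> 'f) set) monoid))"
    and "real (order G) = real (b_max G) * (real (b_max G) + e)"
  shows "e > sqrt (real (b_max G)) + 1 \<and> real (order G) < e ^ 4 - e ^ 3"
proof -
  let ?P = "product_group {..<k} (\<lambda>_. (PSL2 :: (('f \<times> 'f \<times> 'f \<times> 'f) set) monoid))"
  interpret C: finite_char2 F
    using assms(3,5) char2_if_card_power2 by unfold_locales blast
  have q: "C.q = q" using assms(5) by (simp add: C.q_def)
  have N: "N \<lhd> G" and N1: "N \<noteq> {\<one>\<^bsub>G\<^esub>}" using assms(6) by (auto simp: minimal_normal_def)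
  interpret normal N G by fact
  obtain h where h: "h \<in> iso (G\<lparr>carrier := N\<rparr>) ?P" using assms(7) by (auto simp: is_iso_def)
  have cardN: "card N = (q * (q\<^sup>2 - 1)) ^ k"
  proof -
    have "card N = card (carrier ?P)" using h bij_betw_same_card by (fastforce simp: iso_def)
    then show ?thesis by (simp add: card_PiE C.card_PSL2 q)
  qed
  \<comment> \<open>For \<open>k = 0\<close> the subgroup \<open>N\<close> would be trivial.
    Positivity of \<open>k\<close> allows bounding the power \<open>v\<close> by a single
    factor.\<close>
  have k: "k > 0"
  proof (rule ccontr)
    assume "\<not> ?thesis"
    then obtain x where "N = {x}" using cardN card_1_singletonE[of N] by auto
    then show False using N1 subgroup.one_closed[OF subgroup_axioms] by (metis singletonD)
  qed
  define v where "v = (2 / (real q + 1)) ^ k"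
  have "sign_element ?P v"
    using sign_element_product_group[OF C.group_PSL2 finite_lessThan _ C.sign_element_PSL2, of k]
    by (simp add: v_def q)
  then have sign: "sign_element (G\<lparr>carrier := N\<rparr>) v"
    using h C.group_PSL2 subgroup_imp_group[OF subgroup_axioms] by (intro sign_element_iso[OF _ _ h]) auto
  \<comment> \<open>Here \<open>q \<ge> 8\<close> enters; \<open>1 + 2 / 9 = 11 / 9\<close> is the
    source of the constants 18 and 11 below.\<close>
  have v: "0 \<le> v" "v \<le> 2 / 9"
  proof -
    have q8: "2 / (real q + 1) \<le> 2 / 9" using assms(4) by (intro divide_left_mono) auto
    have "v \<le> (2 / (real q + 1)) ^ 1" unfolding v_def using k assms(4) by (intro power_decreasing) auto
    then show "v \<le> 2 / 9" using q8 by simp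
  qed (simp add: v_def)
  have deg: "18 * real n ^ 2 \<le> 11 * real (order G)" if "irreducible_rep G n \<rho>" for n \<rho>
  proof -
    have "2 * real n ^ 2 \<le> real (order G) * (1 + \<bar>v\<bar>)" by (rule degree_bound[OF assms(1,2) that N sign])
    also have "\<dots> \<le> real (order G) * (11 / 9)" using v by (intro mult_left_mono) auto
    finally show ?thesis by simp
  qed
  \<comment> \<open>A crude bound, used to make the set of degrees finite.\<close>
  have "n \<le> order G" if "irreducible_rep G n \<rho>" for n \<rho>
  proof -
    have "n * n \<le> order G" using deg[OF that] by (simp add: power2_eq_square flip: of_nat_mult)
    then show ?thesis using le_square order_trans by blast
  qed
  then obtain \<rho> where irr: "irreducible_rep G (b_max G) \<rho>" by (rule irreducible_rep_b_max[OF assms(1)])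
  \<comment> \<open>504 is the order of PSL2(8), the smallest case.\<close>
  have "8 * (8\<^sup>2 - 1) \<le> q * (q\<^sup>2 - 1)" using assms(4) by (intro mult_mono diff_le_mono power_mono) auto
  then have large: "504 \<le> q * (q\<^sup>2 - 1)" by simp
  also have "\<dots> \<le> card N" unfolding cardN using k large by (intro self_le_power) linarith+
  also have "\<dots> \<le> order G" unfolding order_def using assms(2) subset by (intro card_mono)
  finally have "504 \<le> order G" .
  then show ?thesis
    using quadratic_gap[of "real (b_max G)" e] deg[OF irr] irr
    unfolding assms(8)[symmetric] by (simp add: irreducible_rep_def)
qed

end
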